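(* Let $Y$ be a real reflexive Banach space, let $\mathfrak{D}^1\subset Y$ be an affine subspace modeled on a dense linear subspace $\mathfrak{D}^1_0\subset Y$, and let $\mathfrak{D}^2\subset Y^*$ be an affine subspace modeled on a dense linear subspace $\mathfrak{D}^2_0\subset Y^*$. Let $T>0$, let $\mathcal{H}:[0,T]\times\mathfrak{D}^1\times\mathfrak{D}^2\to\mathbb{R}$ be a smooth Hamiltonian with partial Fréchet derivatives $D_\varphi\mathcal{H}(t,\varphi,\pi)\in Y^*$ and $D_\pi\mathcal{H}(t,\varphi,\pi)\in Y$, let $\varphi_0\in\mathfrak{D}^1$, and let $\pi_1:\mathfrak{D}^1\to\mathfrak{D}^2$ be a mapping. Let $(\varphi,\pi)\in\mathfrak{C}_{\varphi_0}$. Then the free boundary Type II d'Alembert variational principle $$\delta\mathcal{S}[\varphi,\pi]=\langle\pi_1(\varphi(T)),\delta\varphi(T)\rangle\quad\text{for all partial variations }(\delta\varphi,\delta\pi)\in\mathfrak{C}_0$$ holds if and only if Hamilton's equations with Type II free boundary conditions hold: $$\dot\varphi(t)=D_\pi\mathcal{H}(t,\varphi(t),\pi(t)),\qquad\dot\pi(t)=-D_\varphi\mathcal{H}(t,\varphi(t),\pi(t))\qquad\text{for all }t\in(0,T),$$ $$\varphi(0)=\varphi_0,\qquad\pi(T)=\pi_1(\varphi(T)).$$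
   Context: $\langle\cdot,\cdot\rangle:Y^*\times Y\to\mathbb{R}$ is the duality pairing; $Y^{**}$ is identified with $Y$ by reflexivity. Conventions on domains: $\mathfrak{D}^1_0$ and $\mathfrak{D}^2_0$ carry norms for which the inclusions into $Y$ and $Y^*$ are continuous (the norms inherited from $Y$ and $Y^*$ are allowed, as are e.g. graph norms of densely defined operators), and $\mathfrak{D}^1,\mathfrak{D}^2$ carry the corresponding affine topologies. $\mathcal{H}$ is smooth (in particular $C^1$) with respect to these topologies, and its partial derivatives are represented by elements of $Y^*$ and $Y$: $\frac{d}{d\epsilon}|_{\epsilon=0}\mathcal{H}(t,\varphi+\epsilon\delta\varphi,\pi)=\langle D_\varphi\mathcal{H}(t,\varphi,\pi),\delta\varphi\rangle$ for $\delta\varphi\in\mathfrak{D}^1_0$ and $\frac{d}{d\epsilon}|_{\epsilon=0}\mathcal{H}(t,\varphi,\pi+\epsilon\delta\pi)=\langle\delta\pi,D_\pi\mathcal{H}(t,\varphi,\pi)\rangle$ for $\delta\pi\in\mathfrak{D}^2_0$. Curves: $\mathfrak{C}=\big(C^1([0,T],Y)\cap C^0([0,T],\mathfrak{D}^1)\big)\times\big(C^1([0,T],Y^* )\cap C^0([0,T],\mathfrak{D}^2)\big)$ and $\mathfrak{C}_{\varphi_0}=\{(\varphi,\pi)\in\mathfrak{C}:\varphi(0)=\varphi_0\}$. Action on $\mathfrak{C}_{\varphi_0}$: $\mathcal{S}[\varphi,\pi]=\int_0^T[\langle\pi(t),\dot\varphi(t)\rangle-\mathcal{H}(t,\varphi(t),\pi(t))]\,dt$.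 Partial variations: $\mathfrak{C}_0$ is the set of $(\delta\varphi,\delta\pi)\in\big(C^1([0,T],Y)\cap C^0([0,T],\mathfrak{D}^1_0)\big)\times\big(C^1([0,T],Y^* )\cap C^0([0,T],\mathfrak{D}^2_0)\big)$ with $\delta\varphi(0)=0$. The variation of the action is $\delta\mathcal{S}[\varphi,\pi]=\frac{d}{d\epsilon}\big|_{\epsilon=0}\mathcal{S}[\varphi+\epsilon\delta\varphi,\pi+\epsilon\delta\pi]$. *)

theory Defs
  imports "HOL-Analysis.Analysis"
begin

text \<open>
  The dual of \<open>'a\<close> is the type \<open>'a \<Rightarrow>\<^sub>L real\<close> of bounded linear functionals, and the duality
  pairing of \<open>p\<close> with \<open>y\<close> is \<open>blinfun_apply p y\<close>. Reflexivity is surjectivity of the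
  canonical map into the bidual.
\<close>

definition reflexive_space :: "'a::real_normed_vector itself \<Rightarrow> bool" where
  "reflexive_space _ \<longleftrightarrow>
     (\<forall>F :: ('a \<Rightarrow>\<^sub>L real) \<Rightarrow>\<^sub>L real. \<exists>y :: 'a. \<forall>f. blinfun_apply F f = blinfun_apply f y)"

definition modeled_on :: "'a::real_vector set \<Rightarrow> 'a set \<Rightarrow> bool" where
  "modeled_on D V \<longleftrightarrow> (\<exists>x. D = (\<lambda>v. x + v) ` V)"

text \<open>
  A linear subspace \<open>V\<close> carries its own norm \<open>N\<close>, in general different from the ambient one; its
  values outside \<open>V\<close> are irrelevant. An affine space modeled on \<open>V\<close> has the metric
  \<open>N (x - y)\<close>.
\<close>

definition norm_on :: "'a::real_vector set \<Rightarrow> ('a \<Rightarrow> real) \<Rightarrow> bool" where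
  "norm_on V N \<longleftrightarrow>
     (\<forall>x\<in>V. 0 \<le> N x \<and> (N x = 0 \<longleftrightarrow> x = 0)) \<and>
     (\<forall>x\<in>V. \<forall>c. N (c *\<^sub>R x) = \<bar>c\<bar> * N x) \<and>
     (\<forall>x\<in>V. \<forall>y\<in>V. N (x + y) \<le> N x + N y)"

definition continuous_inclusion :: "'a::real_normed_vector set \<Rightarrow> ('a \<Rightarrow> real) \<Rightarrow> bool" where
  "continuous_inclusion V N \<longleftrightarrow> (\<exists>C. \<forall>x\<in>V. norm x \<le> C * N x)"

text \<open>
  Infinite Frechet differentiability of \<open>f\<close> on a subset \<open>S\<close> of an affine space modeled on the
  normed space \<open>(V, N)\<close>. As the type of a k-th derivative depends on k, it is represented by a
  bounded k-linear map on lists of k vectors. Requiring the remainder estimate uniformly in the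
  vectors \<open>vs\<close> means that \<open>A (Suc k)\<close> is the Frechet derivative of \<open>A k\<close> for the operator norm
  on k-linear maps; in particular every \<open>A k\<close> is continuous. Derivatives are taken within \<open>S\<close>,
  hence one-sidedly at boundary points.
\<close>

definition bounded_multilinear_on ::
    "'a::real_vector set \<Rightarrow> ('a \<Rightarrow> real) \<Rightarrow> nat \<Rightarrow> ('a list \<Rightarrow> 'b::real_normed_vector) \<Rightarrow> bool" where
  "bounded_multilinear_on V N k M \<longleftrightarrow>
     (\<forall>vs i v w a b. length vs = k \<longrightarrow> set vs \<subseteq> V \<longrightarrow> i < k \<longrightarrow> v \<in> V \<longrightarrow> w \<in> V \<longrightarrow>
        M (vs[i := a *\<^sub>R v + b *\<^sub>R w]) = a *\<^sub>R M (vs[i := v]) + b *\<^sub>R M (vs[i := w])) \<and>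
     (\<exists>C. \<forall>vs. length vs = k \<longrightarrow> set vs \<subseteq> V \<longrightarrow> norm (M vs) \<le> C * prod_list (map N vs))"

definition smooth_wrt ::
    "'a::real_vector set \<Rightarrow> ('a \<Rightarrow> real) \<Rightarrow> 'a set \<Rightarrow> ('a \<Rightarrow> 'b::real_normed_vector) \<Rightarrow> bool" where
  "smooth_wrt V N S f \<longleftrightarrow>
     (\<exists>A :: nat \<Rightarrow> 'a \<Rightarrow> 'a list \<Rightarrow> 'b.
        (\<forall>x\<in>S. A 0 x [] = f x) \<and>
        (\<forall>k. \<forall>x\<in>S. bounded_multilinear_on V N k (A k x)) \<and>
        (\<forall>k. \<forall>x\<in>S. \<forall>\<epsilon>>0. \<exists>\<delta>>0. \<forall>y\<in>S. N (y - x) < \<delta> \<longrightarrow>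
           (\<forall>vs. length vs = k \<longrightarrow> set vs \<subseteq> V \<longrightarrow>
              norm (A k y vs - A k x vs - A (Suc k) x ((y - x) # vs))
                \<le> \<epsilon> * N (y - x) * prod_list (map N vs))))"

definition smooth_hamiltonian ::
    "real \<Rightarrow> 'a::real_vector set \<Rightarrow> ('a \<Rightarrow> real) \<Rightarrow> 'a set \<Rightarrow>
     'b::real_vector set \<Rightarrow> ('b \<Rightarrow> real) \<Rightarrow> 'b set \<Rightarrow> (real \<Rightarrow> 'a \<Rightarrow> 'b \<Rightarrow> real) \<Rightarrow> bool" where
  "smooth_hamiltonian T V1 N1 D1 V2 N2 D2 H \<longleftrightarrow>
     smooth_wrt (UNIV \<times> V1 \<times> V2) (\<lambda>(s, x, p). \<bar>s\<bar> + N1 x + N2 p)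
       ({0..T} \<times> D1 \<times> D2) (\<lambda>(t, x, p). H t x p)"

text \<open>Only the values of curves on \<open>[0, T]\<close> matter; derivatives at 0 and T are one-sided.\<close>

definition velocity :: "real \<Rightarrow> (real \<Rightarrow> 'a::real_normed_vector) \<Rightarrow> real \<Rightarrow> 'a" where
  "velocity T c t = vector_derivative c (at t within {0..T})"

definition C1_curve :: "real \<Rightarrow> (real \<Rightarrow> 'a::real_normed_vector) \<Rightarrow> bool" where
  "C1_curve T c \<longleftrightarrow>
     (\<forall>t\<in>{0..T}. c differentiable (at t within {0..T})) \<and>
     continuous_on {0..T} (velocity T c)"

definition C0_curve_in :: "real \<Rightarrow> ('a::real_vector \<Rightarrow> real) \<Rightarrow> 'a set \<Rightarrow> (real \<Rightarrow> 'a) \<Rightarrow> bool" where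
  "C0_curve_in T N D c \<longleftrightarrow>
     (\<forall>t\<in>{0..T}. c t \<in> D \<and> ((\<lambda>s. N (c s - c t)) \<longlongrightarrow> 0) (at t within {0..T}))"

definition phase_curves ::
    "real \<Rightarrow> ('a::real_normed_vector \<Rightarrow> real) \<Rightarrow> 'a set \<Rightarrow> (('a \<Rightarrow>\<^sub>L real) \<Rightarrow> real) \<Rightarrow>
     ('a \<Rightarrow>\<^sub>L real) set \<Rightarrow> ((real \<Rightarrow> 'a) \<times> (real \<Rightarrow> 'a \<Rightarrow>\<^sub>L real)) set" where
  "phase_curves T N1 D1 N2 D2 =
     {(\<phi>, \<pi>). C1_curve T \<phi> \<and> C0_curve_in T N1 D1 \<phi> \<and> C1_curve T \<pi> \<and> C0_curve_in T N2 D2 \<pi>}"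

definition phase_curves_from ::
    "real \<Rightarrow> ('a::real_normed_vector \<Rightarrow> real) \<Rightarrow> 'a set \<Rightarrow> (('a \<Rightarrow>\<^sub>L real) \<Rightarrow> real) \<Rightarrow>
     ('a \<Rightarrow>\<^sub>L real) set \<Rightarrow> 'a \<Rightarrow> ((real \<Rightarrow> 'a) \<times> (real \<Rightarrow> 'a \<Rightarrow>\<^sub>L real)) set" where
  "phase_curves_from T N1 D1 N2 D2 \<phi>0 =
     {(\<phi>, \<pi>) \<in> phase_curves T N1 D1 N2 D2. \<phi> 0 = \<phi>0}"

text \<open>Here \<open>V1\<close> and \<open>V2\<close> are the linear model spaces, not the affine domains.\<close>

definition partial_variations ::
    "real \<Rightarrow> ('a::real_normed_vector \<Rightarrow> real) \<Rightarrow> 'a set \<Rightarrow> (('a \<Rightarrow>\<^sub>L real) \<Rightarrow> real) \<Rightarrow>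
     ('a \<Rightarrow>\<^sub>L real) set \<Rightarrow> ((real \<Rightarrow> 'a) \<times> (real \<Rightarrow> 'a \<Rightarrow>\<^sub>L real)) set" where
  "partial_variations T N1 V1 N2 V2 =
     {(\<delta>\<phi>, \<delta>\<pi>) \<in> phase_curves T N1 V1 N2 V2. \<delta>\<phi> 0 = 0}"

definition action ::
    "real \<Rightarrow> (real \<Rightarrow> 'a::real_normed_vector \<Rightarrow> ('a \<Rightarrow>\<^sub>L real) \<Rightarrow> real) \<Rightarrow>
     (real \<Rightarrow> 'a) \<Rightarrow> (real \<Rightarrow> 'a \<Rightarrow>\<^sub>L real) \<Rightarrow> real" where
  "action T H \<phi> \<pi> =
     integral {0..T} (\<lambda>t. blinfun_apply (\<pi> t) (velocity T \<phi> t) - H t (\<phi> t) (\<pi> t))"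

text \<open>
  The variation exists as a derivative and has the value \<open>d\<close>; a relation rather than a
  function, so that an equation for the variation includes its existence.
\<close>

definition has_action_variation ::
    "real \<Rightarrow> (real \<Rightarrow> 'a::real_normed_vector \<Rightarrow> ('a \<Rightarrow>\<^sub>L real) \<Rightarrow> real) \<Rightarrow>
     (real \<Rightarrow> 'a) \<Rightarrow> (real \<Rightarrow> 'a \<Rightarrow>\<^sub>L real) \<Rightarrow> (real \<Rightarrow> 'a) \<Rightarrow> (real \<Rightarrow> 'a \<Rightarrow>\<^sub>L real) \<Rightarrow> real \<Rightarrow> bool"
  where
  "has_action_variation T H \<phi> \<pi> \<delta>\<phi> \<delta>\<pi> d \<longleftrightarrow>
     ((\<lambda>\<epsilon>. action T H (\<lambda>t. \<phi> t + \<epsilon> *\<^sub>R \<delta>\<phi> t) (\<lambda>t. \<pi> t + \<epsilon> *\<^sub>R \<delta>\<pi> t))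
        has_real_derivative d) (at 0)"

end

theory Submission
  imports Defs
begin

text \<open>
  The action is differentiated under the integral sign: along a curve the partial derivatives of
  the Hamiltonian are values of its total derivative in the norms of the model spaces, which is
  jointly continuous in the time and the variation parameter. Integrating
  \<open>\<langle>\<pi>, \<delta>\<phi>'\<rangle>\<close> by parts turns the variation into
  \<open>\<langle>\<pi> T, \<delta>\<phi> T\<rangle> + \<integral> (\<langle>\<delta>\<pi>, \<phi>' - D\<pi>H\<rangle> - \<langle>\<pi>' + D\<phi>H, \<delta>\<phi>\<rangle>)\<close>. Testing with
  variations \<open>\<eta> v\<close>, \<open>\<eta> q\<close> for scalar \<open>\<eta>\<close> vanishing at \<open>0\<close> and \<open>T\<close> yields the equations of motion
  against the dense model spaces, and \<open>\<eta> t = t\<close> then yields the condition at \<open>T\<close>. That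
  \<open>\<phi>' - D\<pi>H\<close> vanishes, and not merely all functionals on it, is the Hahn-Banach theorem.
\<close>

section \<open>Functionals separate points\<close>

text \<open>Values may be negative, so linear functionals are included; they will appear as the
  minimal elements.\<close>

definition sublinear :: "('a::real_vector \<Rightarrow> real) \<Rightarrow> bool" where
  "sublinear p \<longleftrightarrow> (\<forall>x y. p (x + y) \<le> p x + p y) \<and> (\<forall>c\<ge>0. \<forall>x. p (c *\<^sub>R x) = c * p x)"

text \<open>One inequality for positive scalars suffices, since scaling back by \<open>1 / c\<close>
  gives the other. Infima naturally provide just this half.\<close>

lemma sublinearI:
  assumes add: "\<And>x y. p (x + y) \<le> p x + p y" and zero: "p 0 = 0"
    and scale: "\<And>c x. c > 0 \<Longrightarrow> p (c *\<^sub>R x) \<le> c * p x"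
  shows "sublinear p"
proof -
  have "p (c *\<^sub>R x) = c * p x" if "c \<ge> 0" for c x
  proof (cases "c = 0")
    case False
    with that have c: "c > 0" by simp
    have "p ((1 / c) *\<^sub>R c *\<^sub>R x) \<le> (1 / c) * p (c *\<^sub>R x)"
      using c by (intro scale) simp
    then have "c * p x \<le> p (c *\<^sub>R x)"
      using c by (simp add: field_simps)
    with scale[OF c, of x] show ?thesis by simp
  qed (simp add: zero)
  with add show ?thesis unfolding sublinear_def by blast
qed

lemma sublinear_zero: "sublinear p \<Longrightarrow> p 0 = 0"
  unfolding sublinear_def by (metis mult_zero_left order_refl scale_zero_left)

text \<open>Subadditivity at \<open>x + - x\<close>. It keeps infima along chains finite and gives
  one half of oddness for a minimal functional.\<close>

lemma sublinear_minus:
  assumes "sublinear p" shows "- p (- x) \<le> p x"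
proof -
  have "p (x + - x) \<le> p x + p (- x)"
    using assms unfolding sublinear_def by blast
  then show ?thesis using sublinear_zero[OF assms] by simp
qed

text \<open>The witness is \<open>q x = INF t\<ge>0. p (x + t y) - t p y\<close>.\<close>

lemma sublinear_shift:
  assumes p: "sublinear p"
  obtains q where "sublinear q" "\<And>x. q x \<le> p x" "q (- y) \<le> - p y"
proof
  let ?g = "\<lambda>x t. p (x + t *\<^sub>R y) - t * p y"
  let ?q = "\<lambda>x. INF t\<in>{0..}. ?g x t"
  have add: "p (a + b) \<le> p a + p b" for a b
    using p unfolding sublinear_def by blast
  have hom: "p (c *\<^sub>R a) = c * p a" if "c \<ge> 0" for c a
    using p that unfolding sublinear_def by blast
  \<comment> \<open>From \<open>t *\<^sub>R y = (x + t *\<^sub>R y) + - x\<close>; this bound,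
    uniform in \<open>t\<close>, makes the infimum a genuine one.\<close>
  have low: "- p (- x) \<le> ?g x t" if "t \<ge> 0" for x t
    using add[of "x + t *\<^sub>R y" "- x"] hom[OF that, of y] by simp
  have bdd: "bdd_below (?g x ` {0..})" for x
    by (rule bdd_belowI2[where m = "- p (- x)"]) (use low in auto)
  have le: "?q x \<le> ?g x t" if "t \<ge> 0" for x t
    using that by (intro cINF_lower[OF bdd]) auto
  show "?q x \<le> p x" for x
    using le[of 0 x] by simp
  show "?q (- y) \<le> - p y"
    using le[of 1 "- y"] sublinear_zero[OF p] by simp
  show "sublinear ?q"
  proof (rule sublinearI)
    fix x1 x2
    \<comment> \<open>The parameters add: \<open>t1 + t2\<close> is a competitor for
      \<open>x1 + x2\<close>. The infima over \<open>t1\<close> and \<open>t2\<close> are then taken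
      one after the other.\<close>
    have "?q (x1 + x2) \<le> ?g x1 t1 + ?g x2 t2" if "t1 \<ge> 0" "t2 \<ge> 0" for t1 t2
    proof -
      have "?q (x1 + x2) \<le> ?g (x1 + x2) (t1 + t2)"
        using that by (intro le) simp
      also have "\<dots> \<le> ?g x1 t1 + ?g x2 t2"
        using add[of "x1 + t1 *\<^sub>R y" "x2 + t2 *\<^sub>R y"] by (simp add: algebra_simps)
      finally show ?thesis .
    qed
    then have "?q (x1 + x2) - ?g x2 t2 \<le> ?q x1" if "t2 \<ge> 0" for t2
      using that by (intro cINF_greatest) (auto simp: algebra_simps)
    then have "?q (x1 + x2) - ?q x1 \<le> ?q x2"
      by (intro cINF_greatest) (auto simp: algebra_simps)
    then show "?q (x1 + x2) \<le> ?q x1 + ?q x2" by simp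
  next
    show "?q 0 = 0"
      by (simp add: hom cong: INF_cong_simp)
  next
    fix c :: real and x assume c: "c > 0"
    have "?q (c *\<^sub>R x) / c \<le> ?g x t" if "t \<ge> 0" for t
    proof -
      have "?q (c *\<^sub>R x) \<le> ?g (c *\<^sub>R x) (c * t)"
        using that c by (intro le) simp
      also have "\<dots> = c * ?g x t"
        using hom[of c "x + t *\<^sub>R y"] c by (simp add: algebra_simps)
      finally show ?thesis using c by (simp add: field_simps)
    qed
    then have "?q (c *\<^sub>R x) / c \<le> ?q x"
      by (intro cINF_greatest) auto
    then show "?q (c *\<^sub>R x) \<le> c * ?q x" using c by (simp add: field_simps)
  qed
qed

text \<open>Zorn's lemma for the reversed pointwise order, so that maximal means minimal. A nonempty
  chain is bounded by its pointwise infimum, which stays subadditive because any two members of the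
  chain are comparable.\<close>

lemma sublinear_minimal:
  fixes q :: "'a::real_vector \<Rightarrow> real"
  assumes q: "sublinear q"
  obtains m where "sublinear m" "\<And>x. m x \<le> q x"
    "\<And>p. sublinear p \<Longrightarrow> (\<And>x. p x \<le> m x) \<Longrightarrow> p = m"
proof -
  let ?A = "{p. sublinear p \<and> (\<forall>x. p x \<le> q x)}"
  let ?P = "\<lambda>f g. \<forall>x :: 'a. g x \<le> (f x :: real)"
  have "\<exists>m\<in>?A. \<forall>a\<in>?A. ?P m a \<longrightarrow> a = m"
  proof (rule predicate_Zorn)
    show "partial_order_on ?A (relation_of ?P ?A)"
      by (rule partial_order_on_relation_ofI) (auto intro: order_trans simp: fun_eq_iff antisym)
  next
    fix C assume C: "C \<in> Chains (relation_of ?P ?A)"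
    show "\<exists>u\<in>?A. \<forall>a\<in>C. ?P a u"
    proof (cases "C = {}")
      case True
      then show ?thesis using q by auto
    next
      case False
      have CA: "C \<subseteq> ?A" using Chains_relation_of[OF C] .
      have chain: "?P a b \<or> ?P b a" if "a \<in> C" "b \<in> C" for a b
        using C that unfolding Chains_def relation_of_def by auto
      let ?u = "\<lambda>x. INF p\<in>C. p x"
      \<comment> \<open>\<open>p \<le> q\<close> at \<open>- x\<close> turns the bound
        \<open>- p (- x) \<le> p x\<close> into one that is the same for the whole chain.\<close>
      have low: "- q (- x) \<le> p x" if "p \<in> C" for p x
        using CA that sublinear_minus[of p x] by (force intro: order_trans[rotated])
      have le: "?u x \<le> p x" if "p \<in> C" for p x
        by (intro cINF_lower bdd_belowI2[where m = "- q (- x)"]) (use low that in auto)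
      have "sublinear ?u"
      proof (rule sublinearI)
        fix x y
        have "?u (x + y) \<le> p1 x + p2 y" if p: "p1 \<in> C" "p2 \<in> C" for p1 p2
        proof -
          \<comment> \<open>Of \<open>p1\<close> and \<open>p2\<close>, the smaller one serves at
            both points at once.\<close>
          obtain p where "p \<in> C" "p x \<le> p1 x" "p y \<le> p2 y"
            using chain[OF p] p by blast
          moreover have "p (x + y) \<le> p x + p y"
            using CA \<open>p \<in> C\<close> unfolding sublinear_def by auto
          ultimately show ?thesis using le[of p "x + y"] by linarith
        qed
        then have "?u (x + y) - p2 y \<le> ?u x" if "p2 \<in> C" for p2
          using that False by (intro cINF_greatest) (auto simp: algebra_simps)
        then have "?u (x + y) - ?u x \<le> ?u y"
          using False by (intro cINF_greatest) (auto simp: algebra_simps)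
        then show "?u (x + y) \<le> ?u x + ?u y" by simp
      next
        have "(INF p\<in>C. p 0) = (INF p\<in>C. 0)"
          using CA sublinear_zero by (intro INF_cong) auto
        then show "?u 0 = 0" using False by simp
      next
        fix c :: real and x assume c: "c > 0"
        have "?u (c *\<^sub>R x) / c \<le> p x" if "p \<in> C" for p
        proof -
          have "p (c *\<^sub>R x) = c * p x"
            using CA that c unfolding sublinear_def by auto
          with le[OF that, of "c *\<^sub>R x"] c show ?thesis by (simp add: field_simps)
        qed
        then have "?u (c *\<^sub>R x) / c \<le> ?u x"
          using False by (intro cINF_greatest) auto
        then show "?u (c *\<^sub>R x) \<le> c * ?u x" using c by (simp add: field_simps)
      qed
      moreover have "?u x \<le> q x" for x
      proof -
        obtain p where "p \<in> C" using False by blast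
        then show ?thesis using le[of p x] CA by (force intro: order_trans)
      qed
      ultimately show ?thesis using le by (intro bexI[where x = ?u]) auto
    qed
  qed
  then obtain m where m: "m \<in> ?A" and min: "\<And>a. a \<in> ?A \<Longrightarrow> ?P m a \<Longrightarrow> a = m"
    by blast
  show thesis
  proof
    show "sublinear m" "m x \<le> q x" for x using m by auto
    \<comment> \<open>Anything below \<open>m\<close> is below \<open>q\<close>, so minimality
      inside \<open>?A\<close> is minimality among all sublinear functionals.\<close>
    show "p = m" if "sublinear p" "\<And>x. p x \<le> m x" for p
      using that m by (intro min) (auto intro: order_trans)
  qed
qed

text \<open>
  A minimal sublinear functional \<open>m\<close> is linear: by minimality it equals its shift along \<open>y\<close>,
  so \<open>m (- y) \<le> - m y\<close>.
\<close>

lemma sublinear_dominates_linear: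
  fixes q :: "'a::real_vector \<Rightarrow> real"
  assumes "sublinear q"
  obtains f where "linear f" "\<And>x. f x \<le> q x"
proof -
  obtain m where m: "sublinear m" and mq: "\<And>x. m x \<le> q x"
    and min: "\<And>p. sublinear p \<Longrightarrow> (\<And>x. p x \<le> m x) \<Longrightarrow> p = m"
    using sublinear_minimal[OF assms] by blast
  have minus: "m (- y) = - m y" for y
  proof -
    obtain p where "sublinear p" "\<And>x. p x \<le> m x" "p (- y) \<le> - m y"
      using sublinear_shift[OF m, of y] by blast
    with min have "m (- y) \<le> - m y" by metis
    with sublinear_minus[OF m, of y] show ?thesis by simp
  qed
  have sub: "m (x + y) \<le> m x + m y" for x y
    using m unfolding sublinear_def by blast
  have "m (x + y) = m x + m y" for x y
    \<comment> \<open>The second instance reads \<open>m x \<le> m (x + y) + m (- y)\<close>, which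
      by oddness is the missing inequality.\<close>
    using sub[of x y] sub[of "x + y" "- y"] minus[of y] by simp
  moreover have "m (c *\<^sub>R x) = c *\<^sub>R m x" for c x
  proof (cases "c \<ge> 0")
    case True
    then show ?thesis using m unfolding sublinear_def by simp
  next
    case False
    then have "m ((- c) *\<^sub>R x) = (- c) * m x"
      using m unfolding sublinear_def by (metis linear neg_0_le_iff_le)
    then show ?thesis using minus[of "c *\<^sub>R x"] by simp
  qed
  ultimately have "linear m" by (rule linearI)
  with mq that show thesis by blast
qed

text \<open>Shift the norm along \<open>y\<close> and take a linear functional \<open>f\<close>
  below the result. Then \<open>f\<close> is dominated by the norm, hence bounded, while
  \<open>f (- y) \<le> - norm y\<close> forces \<open>f y \<ge> norm y\<close>. So
  \<open>f y = 0\<close> leaves only \<open>y = 0\<close>.\<close>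

lemma dual_separates_points:
  fixes y :: "'a::real_normed_vector"
  assumes "\<And>f :: 'a \<Rightarrow>\<^sub>L real. blinfun_apply f y = 0"
  shows "y = 0"
proof -
  have "sublinear (norm :: 'a \<Rightarrow> real)"
    unfolding sublinear_def by (simp add: norm_triangle_ineq)
  then obtain q where q: "sublinear q" "\<And>x. q x \<le> norm x" "q (- y) \<le> - norm y"
    using sublinear_shift by blast
  obtain f where f: "linear f" "\<And>x. f x \<le> q x"
    using sublinear_dominates_linear[OF q(1)] by blast
  have le: "f x \<le> norm x" for x using f(2) q(2) order_trans by blast
  have "\<bar>f x\<bar> \<le> norm x" for x
    using le[of x] le[of "- x"] linear_neg[OF f(1), of x] by simp
  then have "bounded_linear f"
    using f(1) by (intro bounded_linear_intro[where K = 1])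
      (auto simp: linear_add linear_scale)
  then have "f y = 0"
    using assms[of "Blinfun f"] by (simp add: bounded_linear_Blinfun_apply)
  moreover have "f (- y) \<le> - norm y" using f(2) q(3) order_trans by blast
  ultimately show ?thesis using linear_neg[OF f(1), of y] by simp
qed

section \<open>Derivatives with respect to a norm on a subspace\<close>

lemma subspace_UNIV_times:
  assumes "subspace V1" "subspace V2"
  shows "subspace ((UNIV :: real set) \<times> V1 \<times> V2)"
  using assms unfolding subspace_def by (auto simp: zero_prod_def)

lemma norm_on_zero: "norm_on V N \<Longrightarrow> 0 \<in> V \<Longrightarrow> N 0 = 0"
  unfolding norm_on_def by blast

lemma norm_on_nonneg: "norm_on V N \<Longrightarrow> x \<in> V \<Longrightarrow> 0 \<le> N x"
  unfolding norm_on_def by blast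

lemma norm_on_triangle: "norm_on V N \<Longrightarrow> x \<in> V \<Longrightarrow> y \<in> V \<Longrightarrow> N (x + y) \<le> N x + N y"
  unfolding norm_on_def by blast

lemma norm_on_scale: "norm_on V N \<Longrightarrow> x \<in> V \<Longrightarrow> N (c *\<^sub>R x) = \<bar>c\<bar> * N x"
  unfolding norm_on_def by blast

text \<open>This is the norm in which \<open>smooth_hamiltonian\<close> measures joint increments of
  time, position and momentum.\<close>

lemma norm_on_prod:
  assumes "norm_on V1 N1" "norm_on V2 N2"
  shows "norm_on (UNIV \<times> V1 \<times> V2) (\<lambda>(s :: real, x, p). \<bar>s\<bar> + N1 x + N2 p)"
  unfolding norm_on_def
proof (intro conjI ballI allI)
  fix z assume z: "z \<in> (UNIV :: real set) \<times> V1 \<times> V2"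
  obtain s x p where zd: "z = (s, x, p)" "x \<in> V1" "p \<in> V2" using z by auto
  have nn: "0 \<le> N1 x" "0 \<le> N2 p" using assms zd norm_on_nonneg by blast+
  then show "0 \<le> (case z of (s, x, p) \<Rightarrow> \<bar>s\<bar> + N1 x + N2 p)" by (simp add: zd)
  have "\<bar>s\<bar> + N1 x + N2 p = 0 \<longleftrightarrow> s = 0 \<and> N1 x = 0 \<and> N2 p = 0"
    using nn by auto
  also have "\<dots> \<longleftrightarrow> z = 0"
    using assms zd unfolding norm_on_def by (auto simp: zero_prod_def)
  finally show "((case z of (s, x, p) \<Rightarrow> \<bar>s\<bar> + N1 x + N2 p) = 0) = (z = 0)"
    by (simp add: zd)
  show "(case c *\<^sub>R z of (s, x, p) \<Rightarrow> \<bar>s\<bar> + N1 x + N2 p) =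
      \<bar>c\<bar> * (case z of (s, x, p) \<Rightarrow> \<bar>s\<bar> + N1 x + N2 p)" for c
    using norm_on_scale[OF assms(1) zd(2), of c] norm_on_scale[OF assms(2) zd(3), of c]
    by (simp add: zd abs_mult algebra_simps)
  fix w assume w: "w \<in> (UNIV :: real set) \<times> V1 \<times> V2"
  obtain s' x' p' where wd: "w = (s', x', p')" "x' \<in> V1" "p' \<in> V2" using w by auto
  show "(case z + w of (s, x, p) \<Rightarrow> \<bar>s\<bar> + N1 x + N2 p)
      \<le> (case z of (s, x, p) \<Rightarrow> \<bar>s\<bar> + N1 x + N2 p) + (case w of (s, x, p) \<Rightarrow> \<bar>s\<bar> + N1 x + N2 p)"
    using norm_on_triangle[OF assms(1) zd(2) wd(2)] norm_on_triangle[OF assms(2) zd(3) wd(3)]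
    by (simp add: zd wd)
qed

lemma modeled_on_diff:
  assumes "modeled_on D V" "subspace V" "x \<in> D" "y \<in> D"
  shows "x - y \<in> V"
proof -
  obtain o' where "D = (\<lambda>v. o' + v) ` V" using assms(1) unfolding modeled_on_def by blast
  then obtain v w where "v \<in> V" "w \<in> V" "x = o' + v" "y = o' + w" using assms(3,4) by blast
  then show ?thesis using subspace_diff[OF assms(2)] by simp
qed

lemma modeled_on_add:
  assumes "modeled_on D V" "subspace V" "x \<in> D" "v \<in> V"
  shows "x + v \<in> D"
proof -
  obtain o' where D: "D = (\<lambda>v. o' + v) ` V" using assms(1) unfolding modeled_on_def by blast
  then obtain w where "w \<in> V" "x = o' + w" using assms(3) by blast
  then show ?thesis
    using subspace_add[OF assms(2) \<open>w \<in> V\<close> assms(4)] unfolding D by (auto simp: add.assoc)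
qed

text \<open>
  Only the first two derivatives matter: the second one serves to make the first locally
  Lipschitz in the operator norm.
\<close>

lemma smooth_wrt_first_derivative:
  fixes f :: "'a::real_vector \<Rightarrow> 'b::real_normed_vector"
  assumes V: "subspace V" and N: "norm_on V N" and sm: "smooth_wrt V N S f"
    and diff: "\<And>x y. x \<in> S \<Longrightarrow> y \<in> S \<Longrightarrow> x - y \<in> V"
  obtains L where
    "\<And>x a b v w. x \<in> S \<Longrightarrow> v \<in> V \<Longrightarrow> w \<in> V \<Longrightarrow> L x (a *\<^sub>R v + b *\<^sub>R w) = a *\<^sub>R L x v + b *\<^sub>R L x w"
    "\<And>x. x \<in> S \<Longrightarrow> \<exists>C\<ge>0. \<forall>v\<in>V. norm (L x v) \<le> C * N v"
    "\<And>x e. x \<in> S \<Longrightarrow> e > 0 \<Longrightarrow>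
       \<exists>d>0. \<forall>y\<in>S. N (y - x) < d \<longrightarrow> norm (f y - f x - L x (y - x)) \<le> e * N (y - x)"
    "\<And>x. x \<in> S \<Longrightarrow> \<exists>C\<ge>0. \<exists>d>0. \<forall>y\<in>S. N (y - x) < d \<longrightarrow>
       (\<forall>v\<in>V. norm (L y v - L x v) \<le> C * N (y - x) * N v)"
proof -
  from sm[unfolded smooth_wrt_def] obtain A :: "nat \<Rightarrow> 'a \<Rightarrow> 'a list \<Rightarrow> 'b" where
    A0: "\<forall>x\<in>S. A 0 x [] = f x" and
    mult: "\<forall>k. \<forall>x\<in>S. bounded_multilinear_on V N k (A k x)" and
    rem: "\<forall>k. \<forall>x\<in>S. \<forall>e>0. \<exists>d>0. \<forall>y\<in>S. N (y - x) < d \<longrightarrow>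
           (\<forall>vs. length vs = k \<longrightarrow> set vs \<subseteq> V \<longrightarrow>
              norm (A k y vs - A k x vs - A (Suc k) x ((y - x) # vs))
                \<le> e * N (y - x) * prod_list (map N vs))"
    by (elim exE conjE) (rule that)
  note A0 = A0[rule_format] and mult = mult[rule_format] and rem = rem[rule_format]
  have bd: "\<exists>C\<ge>0. \<forall>vs. length vs = k \<longrightarrow> set vs \<subseteq> V \<longrightarrow> norm (A k x vs) \<le> C * prod_list (map N vs)"
    if x: "x \<in> S" for k x
  proof -
    obtain C where C: "\<And>vs. length vs = k \<Longrightarrow> set vs \<subseteq> V \<Longrightarrow> norm (A k x vs) \<le> C * prod_list (map N vs)"
      using mult[OF x, of k] unfolding bounded_multilinear_on_def by blast
    \<comment> \<open>The bound in \<open>bounded_multilinear_on\<close> leaves the sign of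
      \<open>C\<close> open; \<open>max C 0\<close> is a nonnegative replacement because the product
      of norms is nonnegative.\<close>
    have "norm (A k x vs) \<le> max C 0 * prod_list (map N vs)" if "length vs = k" "set vs \<subseteq> V" for vs
    proof -
      have "0 \<le> prod_list (map N vs)"
        using that(2) norm_on_nonneg[OF N] by (intro prod_list_nonneg) auto
      then show ?thesis using C[OF that] mult_right_mono[of C "max C 0"] by (meson max.cobounded1 order_trans)
    qed
    then show ?thesis by (intro exI[of _ "max C 0"]) auto
  qed
  define L where "L x v = A 1 x [v]" for x v
  show thesis
  proof
    fix x v w and a b :: real assume x: "x \<in> S" and v: "v \<in> V" and w: "w \<in> V"
    \<comment> \<open>The only entry is overwritten, so the initial \<open>[v]\<close> merely
      supplies a list of length one.\<close>
    have "A 1 x ([v][0 := a *\<^sub>R v + b *\<^sub>R w]) = a *\<^sub>R A 1 x ([v][0 := v]) + b *\<^sub>R A 1 x ([v][0 := w])"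
      using mult[OF x, of 1, unfolded bounded_multilinear_on_def, THEN conjunct1, rule_format,
          of "[v]" 0 v w a b] v w by simp
    then show "L x (a *\<^sub>R v + b *\<^sub>R w) = a *\<^sub>R L x v + b *\<^sub>R L x w"
      by (simp add: L_def)
  next
    fix x assume x: "x \<in> S"
    obtain C where "C \<ge> 0" and
      C: "\<And>vs. length vs = 1 \<Longrightarrow> set vs \<subseteq> V \<Longrightarrow> norm (A 1 x vs) \<le> C * prod_list (map N vs)"
      using bd[OF x, of 1] by blast
    then show "\<exists>C\<ge>0. \<forall>v\<in>V. norm (L x v) \<le> C * N v"
      using C[of "[v]" for v] by (intro exI[of _ C]) (auto simp: L_def)
  next
    fix x and e :: real assume x: "x \<in> S" and e: "e > 0"
    obtain d where "d > 0" and d: "\<And>y. y \<in> S \<Longrightarrow> N (y - x) < d \<Longrightarrow>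
       norm (A 0 y [] - A 0 x [] - A (Suc 0) x [y - x]) \<le> e * N (y - x) * prod_list (map N [])"
      using rem[OF x e, of 0] by auto
    then show "\<exists>d>0. \<forall>y\<in>S. N (y - x) < d \<longrightarrow> norm (f y - f x - L x (y - x)) \<le> e * N (y - x)"
      using A0 x by (intro exI[of _ d]) (auto simp: L_def)
  next
    fix x assume x: "x \<in> S"
    \<comment> \<open>The remainder estimate for the first derivative with tolerance 1; together
      with the bound \<open>C\<close> on the second derivative it gives the Lipschitz constant
      \<open>C + 1\<close>.\<close>
    obtain d where "d > 0" and d: "\<And>y vs. y \<in> S \<Longrightarrow> N (y - x) < d \<Longrightarrow> length vs = 1 \<Longrightarrow> set vs \<subseteq> V \<Longrightarrow>
       norm (A 1 y vs - A 1 x vs - A (Suc 1) x ((y - x) # vs)) \<le> 1 * N (y - x) * prod_list (map N vs)"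
      using rem[OF x zero_less_one, of 1] by blast
    obtain C where "C \<ge> 0" and
      C: "\<And>vs. length vs = Suc 1 \<Longrightarrow> set vs \<subseteq> V \<Longrightarrow> norm (A (Suc 1) x vs) \<le> C * prod_list (map N vs)"
      using bd[OF x, of "Suc 1"] by blast
    have "norm (L y v - L x v) \<le> (C + 1) * N (y - x) * N v"
      if y: "y \<in> S" "N (y - x) < d" and v: "v \<in> V" for y v
    proof -
      have "norm (L y v - L x v)
          \<le> norm (A 1 y [v] - A 1 x [v] - A (Suc 1) x [y - x, v]) + norm (A (Suc 1) x [y - x, v])"
        unfolding L_def
        using norm_triangle_sub[of "A 1 y [v] - A 1 x [v]" "A (Suc 1) x [y - x, v]"] by simp
      also have "\<dots> \<le> 1 * N (y - x) * N v + C * (N (y - x) * N v)"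
        using d[OF y, of "[v]"] C[of "[y - x, v]"] diff[OF y(1) x] v by (intro add_mono) auto
      finally show ?thesis by (simp add: algebra_simps)
    qed
    then show "\<exists>C\<ge>0. \<exists>d>0. \<forall>y\<in>S. N (y - x) < d \<longrightarrow> (\<forall>v\<in>V. norm (L y v - L x v) \<le> C * N (y - x) * N v)"
      using \<open>d > 0\<close> \<open>C \<ge> 0\<close> by (intro exI[of _ "C + 1"] conjI exI[of _ d]) auto
  qed
qed

section \<open>Continuity and line derivatives obtained from the first derivative\<close>

text \<open>Split the difference into \<open>L (X s) (W s) - L x (W s)\<close>, small by the
  Lipschitz estimate since \<open>N (W s)\<close> stays bounded, and \<open>L x (W s - w)\<close>,
  small by boundedness. Convergence is phrased through \<open>N\<close>, which need not induce the
  ambient topology.\<close>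

lemma locally_lipschitz_operator_tendsto:
  fixes L :: "'a::real_vector \<Rightarrow> 'a \<Rightarrow> 'b::real_normed_vector"
  assumes V: "subspace V" and N: "norm_on V N"
    and bnd: "\<exists>C\<ge>0. \<forall>v\<in>V. norm (L x v) \<le> C * N v"
    and lin: "\<And>v w. v \<in> V \<Longrightarrow> w \<in> V \<Longrightarrow> L x (v - w) = L x v - L x w"
    and lip: "\<exists>C\<ge>0. \<exists>d>0. \<forall>y\<in>S. N (y - x) < d \<longrightarrow>
       (\<forall>v\<in>V. norm (L y v - L x v) \<le> C * N (y - x) * N v)"
    and w: "w \<in> V"
    and XS: "eventually (\<lambda>s. X s \<in> S) F" and WV: "eventually (\<lambda>s. W s \<in> V) F"
    and X: "((\<lambda>s. N (X s - x)) \<longlongrightarrow> 0) F" and W: "((\<lambda>s. N (W s - w)) \<longlongrightarrow> 0) F"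
  shows "((\<lambda>s. L (X s) (W s)) \<longlongrightarrow> L x w) F"
proof -
  obtain C where C: "\<And>v. v \<in> V \<Longrightarrow> norm (L x v) \<le> C * N v" using bnd by blast
  obtain K d where K: "K \<ge> 0" and d: "d > 0" and
    Kd: "\<And>y v. y \<in> S \<Longrightarrow> N (y - x) < d \<Longrightarrow> v \<in> V \<Longrightarrow> norm (L y v - L x v) \<le> K * N (y - x) * N v"
    using lip by blast
  \<comment> \<open>The absolute value is taken because \<open>X s - x\<close> is not assumed to lie
    in \<open>V\<close>, where \<open>N\<close> is known to be nonnegative.\<close>
  let ?B = "\<lambda>s. K * \<bar>N (X s - x)\<bar> * (N (W s - w) + N w) + C * N (W s - w)"
  have "eventually (\<lambda>s. N (X s - x) < d) F"
    using order_tendstoD(2)[OF X d] .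
  with XS WV have ev: "eventually (\<lambda>s. norm (L (X s) (W s) - L x w) \<le> ?B s) F"
  proof eventually_elim
    case (elim s)
    have dV: "W s - w \<in> V" using elim w subspace_diff[OF V] by blast
    have "N (W s) \<le> N (W s - w) + N w"
      using norm_on_triangle[OF N dV w] by simp
    moreover have "norm (L (X s) (W s) - L x (W s)) \<le> K * \<bar>N (X s - x)\<bar> * N (W s)"
      using Kd[OF elim(1,3,2)] K norm_on_nonneg[OF N elim(2)]
      by (meson abs_ge_self mult_left_mono mult_right_mono order_trans)
    ultimately have 1: "norm (L (X s) (W s) - L x (W s)) \<le> K * \<bar>N (X s - x)\<bar> * (N (W s - w) + N w)"
      using K by (meson abs_ge_zero mult_left_mono mult_nonneg_nonneg order_trans)
    have "norm (L x (W s) - L x w) \<le> C * N (W s - w)"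
      using C[OF dV] lin[OF elim(2) w] by simp
    with 1 show ?case
      using norm_triangle_ineq[of "L (X s) (W s) - L x (W s)" "L x (W s) - L x w"] by simp
  qed
  have "(?B \<longlongrightarrow> K * \<bar>0\<bar> * (0 + N w) + C * 0) F"
    by (intro tendsto_intros X W)
  then have "(?B \<longlongrightarrow> 0) F" by simp
  with ev have "((\<lambda>s. L (X s) (W s) - L x w) \<longlongrightarrow> 0) F"
    by (rule Lim_null_comparison)
  then show ?thesis by (simp add: LIM_zero_iff)
qed

text \<open>With tolerance 1 in the remainder, \<open>f\<close> moves by at most
  \<open>(1 + C) * N (y - x)\<close> near \<open>x\<close>.\<close>

lemma first_derivative_imp_tendsto:
  fixes f :: "'a::real_vector \<Rightarrow> 'b::real_normed_vector"
  assumes bnd: "\<exists>C\<ge>0. \<forall>v\<in>V. norm (L x v) \<le> C * N v"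
    and rem: "\<And>e. e > 0 \<Longrightarrow>
       \<exists>d>0. \<forall>y\<in>S. N (y - x) < d \<longrightarrow> norm (f y - f x - L x (y - x)) \<le> e * N (y - x)"
    and diff: "\<And>y. y \<in> S \<Longrightarrow> y - x \<in> V"
    and XS: "eventually (\<lambda>s. X s \<in> S) F" and X: "((\<lambda>s. N (X s - x)) \<longlongrightarrow> 0) F"
  shows "((\<lambda>s. f (X s)) \<longlongrightarrow> f x) F"
proof -
  obtain C where C: "\<And>v. v \<in> V \<Longrightarrow> norm (L x v) \<le> C * N v" using bnd by blast
  obtain d where d: "d > 0" and
    rd: "\<And>y. y \<in> S \<Longrightarrow> N (y - x) < d \<Longrightarrow> norm (f y - f x - L x (y - x)) \<le> N (y - x)"
    using rem[of 1] by auto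
  have "eventually (\<lambda>s. N (X s - x) < d) F"
    using order_tendstoD(2)[OF X d] .
  with XS have "eventually (\<lambda>s. norm (f (X s) - f x) \<le> (1 + C) * N (X s - x)) F"
  proof eventually_elim
    case (elim s)
    show ?case
      using rd[OF elim] C[OF diff[OF elim(1)]]
        norm_triangle_sub[of "f (X s) - f x" "L x (X s - x)"] by (simp add: algebra_simps)
  qed
  moreover have "((\<lambda>s. (1 + C) * N (X s - x)) \<longlongrightarrow> 0) F"
    using tendsto_mult_right_zero[OF X] by blast
  ultimately have "((\<lambda>s. f (X s) - f x) \<longlongrightarrow> 0) F"
    by (rule Lim_null_comparison)
  then show ?thesis by (simp add: LIM_zero_iff)
qed

text \<open>The chain rule for an affine line. As the whole line lies in \<open>S\<close>, a
  derivative taken within \<open>S\<close> becomes a two-sided derivative in the parameter.\<close>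

lemma first_derivative_along_line:
  fixes f :: "'a::real_vector \<Rightarrow> real"
  assumes N: "norm_on V N" and w: "w \<in> V"
    and S: "\<And>r. z + r *\<^sub>R w \<in> S" and x: "x = z + r0 *\<^sub>R w"
    and lin: "\<And>c. L x (c *\<^sub>R w) = c * L x w"
    and rem: "\<And>e. e > 0 \<Longrightarrow>
       \<exists>d>0. \<forall>y\<in>S. N (y - x) < d \<longrightarrow> norm (f y - f x - L x (y - x)) \<le> e * N (y - x)"
  shows "((\<lambda>r. f (z + r *\<^sub>R w)) has_real_derivative L x w) (at r0)"
  unfolding has_field_derivative_def has_derivative_at_alt
proof (intro conjI allI impI)
  show "bounded_linear ((*) (L x w))" by (rule bounded_linear_mult_right)
  fix e :: real assume e: "e > 0"
  have Nw: "0 \<le> N w" by (rule norm_on_nonneg[OF N w])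
  \<comment> \<open>Adding 1 keeps the denominator positive when \<open>w = 0\<close>.\<close>
  define e' where "e' = e / (N w + 1)"
  have e': "e' > 0" "e' * N w \<le> e" using e Nw by (auto simp: e'_def field_simps)
  obtain d where d: "d > 0" and
    rd: "\<And>y. y \<in> S \<Longrightarrow> N (y - x) < d \<Longrightarrow> norm (f y - f x - L x (y - x)) \<le> e' * N (y - x)"
    using rem[OF e'(1)] by blast
  show "\<exists>d>0. \<forall>r. norm (r - r0) < d \<longrightarrow>
      norm (f (z + r *\<^sub>R w) - f (z + r0 *\<^sub>R w) - L x w * (r - r0)) \<le> e * norm (r - r0)"
  proof (intro exI conjI allI impI)
    show "0 < d / (N w + 1)" using d Nw by simp
    fix r assume r: "norm (r - r0) < d / (N w + 1)"
    have yx: "z + r *\<^sub>R w - x = (r - r0) *\<^sub>R w" by (simp add: x algebra_simps)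
    have Nyx: "N (z + r *\<^sub>R w - x) = \<bar>r - r0\<bar> * N w"
      unfolding yx by (rule norm_on_scale[OF N w])
    have "\<bar>r - r0\<bar> * N w \<le> \<bar>r - r0\<bar> * (N w + 1)" by (simp add: mult_left_mono)
    also have "\<dots> < d" using r Nw by (simp add: field_simps)
    finally have "norm (f (z + r *\<^sub>R w) - f x - L x ((r - r0) *\<^sub>R w)) \<le> e' * (\<bar>r - r0\<bar> * N w)"
      using rd[OF S, of r] unfolding Nyx unfolding yx by simp
    also have "\<dots> = (e' * N w) * \<bar>r - r0\<bar>" by simp
    also have "\<dots> \<le> e * \<bar>r - r0\<bar>" using e' by (intro mult_right_mono) auto
    finally show "norm (f (z + r *\<^sub>R w) - f (z + r0 *\<^sub>R w) - L x w * (r - r0)) \<le> e * norm (r - r0)"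
      by (simp add: lin x[symmetric] mult.commute)
  qed
qed

section \<open>Curves and test functions\<close>

lemma C1_curve_has_vector_derivative:
  "C1_curve T c \<Longrightarrow> t \<in> {0..T} \<Longrightarrow> (c has_vector_derivative velocity T c t) (at t within {0..T})"
  unfolding C1_curve_def velocity_def by (simp add: vector_derivative_works)

lemma C1_curve_velocity_continuous: "C1_curve T c \<Longrightarrow> continuous_on {0..T} (velocity T c)"
  unfolding C1_curve_def by simp

lemma C1_curve_continuous: "C1_curve T c \<Longrightarrow> continuous_on {0..T} c"
  by (meson C1_curve_has_vector_derivative continuous_on_eq_continuous_within has_vector_derivative_continuous)

text \<open>Since \<open>T > 0\<close>, no point of the interval is isolated, so one-sided
  derivatives are unique at the endpoints as well.\<close>

lemma velocity_eq:
  assumes "T > 0" "t \<in> {0..T}" "(c has_vector_derivative c') (at t within {0..T})"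
  shows "velocity T c t = c'"
  unfolding velocity_def using assms
  by (intro vector_derivative_within) (auto simp: trivial_limit_within islimpt_Icc)

lemma C1_curve_interior_derivative:
  assumes "C1_curve T c" "t \<in> {0<..<T}"
  shows "(c has_vector_derivative velocity T c t) (at t)"
  using C1_curve_has_vector_derivative[OF assms(1), of t] assms(2)
    at_within_interior[of t "{0..T}"] by simp

text \<open>The supply of variations. Increments are multiples of the fixed \<open>v\<close>, so
  continuity in \<open>N\<close> reduces by homogeneity to continuity of the scalar \<eta>.\<close>

lemma scaled_vector_curve:
  fixes v :: "'a::real_normed_vector"
  assumes T: "T > 0" and V: "subspace V" and N: "norm_on V N" and v: "v \<in> V"
    and der: "\<And>t. (\<eta> has_real_derivative \<eta>' t) (at t)" and cont: "continuous_on UNIV \<eta>'"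
  shows "C1_curve T (\<lambda>t. \<eta> t *\<^sub>R v)" "C0_curve_in T N V (\<lambda>t. \<eta> t *\<^sub>R v)"
proof -
  have hv: "((\<lambda>t. \<eta> t *\<^sub>R v) has_vector_derivative \<eta>' t *\<^sub>R v) (at t within {0..T})" for t
    using der[of t] by (auto intro!: derivative_eq_intros has_vector_derivative_scaleR
        intro: has_field_derivative_at_within)
  have "velocity T (\<lambda>t. \<eta> t *\<^sub>R v) t = \<eta>' t *\<^sub>R v" if "t \<in> {0..T}" for t
    using velocity_eq[OF T that hv] .
  moreover have "continuous_on {0..T} (\<lambda>t. \<eta>' t *\<^sub>R v)"
    using cont by (intro continuous_intros) (blast intro: continuous_on_subset)
  ultimately have "continuous_on {0..T} (velocity T (\<lambda>t. \<eta> t *\<^sub>R v))"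
    using continuous_on_cong[where f = "velocity T (\<lambda>t. \<eta> t *\<^sub>R v)" and g = "\<lambda>t. \<eta>' t *\<^sub>R v", OF refl]
    by blast
  then show "C1_curve T (\<lambda>t. \<eta> t *\<^sub>R v)"
    unfolding C1_curve_def using hv
    by (auto intro: differentiableI_vector)
  show "C0_curve_in T N V (\<lambda>t. \<eta> t *\<^sub>R v)"
    unfolding C0_curve_in_def
  proof (intro ballI conjI)
    fix t
    show "\<eta> t *\<^sub>R v \<in> V" using V v by (rule subspace_scale)
    have "N (\<eta> s *\<^sub>R v - \<eta> t *\<^sub>R v) = \<bar>\<eta> s - \<eta> t\<bar> * N v" for s
      using N v unfolding norm_on_def by (simp flip: scaleR_diff_left)
    moreover have "(\<eta> \<longlongrightarrow> \<eta> t) (at t within {0..T})"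
      using DERIV_isCont[OF der[of t]] unfolding isCont_def by (rule tendsto_within_subset) simp
    then have "((\<lambda>s. \<bar>\<eta> s - \<eta> t\<bar> * N v) \<longlongrightarrow> \<bar>\<eta> t - \<eta> t\<bar> * N v) (at t within {0..T})"
      by (intro tendsto_intros)
    ultimately show "((\<lambda>s. N (\<eta> s *\<^sub>R v - \<eta> t *\<^sub>R v)) \<longlongrightarrow> 0) (at t within {0..T})"
      by simp
  qed
qed

section \<open>A C1 bump function and the fundamental lemma\<close>

text \<open>In every combination of signs the first-order remainder is at most
  \<open>(y - u)\<^sup>2\<close>, so the radius \<open>e\<close> itself works for the tolerance
  \<open>e\<close>.\<close>

lemma max_zero_square_derivative:
  "((\<lambda>u :: real. (max 0 u)\<^sup>2) has_real_derivative 2 * max 0 u) (at u)"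
  unfolding has_field_derivative_def has_derivative_at_alt
proof (intro conjI allI impI)
  show "bounded_linear ((*) (2 * max 0 u))" by (rule bounded_linear_mult_right)
  have bound: "\<bar>(max 0 y)\<^sup>2 - (max 0 u)\<^sup>2 - 2 * max 0 u * (y - u)\<bar> \<le> (y - u)\<^sup>2" for y
  proof (cases "u \<le> 0")
    case True
    show ?thesis
    proof (cases "y \<le> 0")
      case False
      then have "y\<^sup>2 \<le> (y - u)\<^sup>2" using True by (intro power_mono) auto
      then show ?thesis using True False by (simp add: max_def)
    qed (use True in \<open>simp add: max_def\<close>)
  next
    case u: False
    show ?thesis
    proof (cases "y \<le> 0")
      case True
      \<comment> \<open>Here the remainder is \<open>u\<^sup>2 - 2 * u * y\<close>, which is
        nonnegative and equals \<open>(y - u)\<^sup>2 - y\<^sup>2\<close>.\<close>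
      then have "u * y \<le> 0" using u by (simp add: mult_nonneg_nonpos)
      then show ?thesis using u True zero_le_power2[of y] zero_le_power2[of u]
        by (simp add: max_def power2_eq_square algebra_simps abs_le_iff)
    next
      case False
      have "y\<^sup>2 - u\<^sup>2 - 2 * u * (y - u) = (y - u)\<^sup>2"
        by (simp add: power2_eq_square algebra_simps)
      then show ?thesis using u False by (simp add: max_def)
    qed
  qed
  fix e :: real assume e: "e > 0"
  show "\<exists>d>0. \<forall>y. norm (y - u) < d \<longrightarrow>
      norm ((max 0 y)\<^sup>2 - (max 0 u)\<^sup>2 - 2 * max 0 u * (y - u)) \<le> e * norm (y - u)"
  proof (intro exI conjI allI impI)
    show "e > 0" by fact
    fix y assume "norm (y - u) < e"
    then have "\<bar>y - u\<bar> * \<bar>y - u\<bar> \<le> e * \<bar>y - u\<bar>" by (intro mult_right_mono) auto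
    with bound[of y] show "norm ((max 0 y)\<^sup>2 - (max 0 u)\<^sup>2 - 2 * max 0 u * (y - u)) \<le> e * norm (y - u)"
      by (simp add: power2_eq_square)
  qed
qed

lemma fundamental_lemma_calculus_of_variations:
  fixes g :: "real \<Rightarrow> real"
  assumes g: "continuous_on {0..T} g"
    and int: "\<And>\<eta> \<eta>'. (\<And>t. (\<eta> has_real_derivative \<eta>' t) (at t)) \<Longrightarrow> continuous_on UNIV \<eta>' \<Longrightarrow>
      \<eta> 0 = 0 \<Longrightarrow> \<eta> T = 0 \<Longrightarrow> integral {0..T} (\<lambda>t. \<eta> t * g t) = 0"
    and t0: "t0 \<in> {0<..<T}"
  shows "g t0 = 0"
proof (rule ccontr)
  assume nz: "g t0 \<noteq> 0"
  \<comment> \<open>Multiplying by the constant \<open>g t0\<close> treats both signs of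
    \<open>g t0\<close> at once.\<close>
  define G where "G t = g t * g t0" for t
  have G: "continuous_on {0..T} G" unfolding G_def by (intro continuous_intros g)
  have G0: "G t0 > 0" using nz by (simp add: G_def zero_less_mult_iff linorder_neq_iff disj_commute)
  obtain d where d: "d > 0" and Gd: "\<And>t. t \<in> {0..T} \<Longrightarrow> dist t t0 < d \<Longrightarrow> dist (G t) (G t0) < G t0"
    using G t0 G0 unfolding continuous_on_iff by (metis atLeastAtMost_iff greaterThanLessThan_iff less_imp_le)
  \<comment> \<open>The radius keeps the bump inside the interval and within the region where
    \<open>G\<close> is positive.\<close>
  define r where "r = min d (min t0 (T - t0))"
  have r: "r > 0" "r \<le> d" "r \<le> t0" "r \<le> T - t0" using d t0 by (auto simp: r_def)
  \<comment> \<open>The parabola \<open>r\<^sup>2 - (t - t0)\<^sup>2\<close>, positive exactly on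
    the open interval of radius \<open>r\<close> about \<open>t0\<close>.\<close>
  define h where "h t = (t - (t0 - r)) * ((t0 + r) - t)" for t
  define \<eta> where "\<eta> t = (max 0 (h t))\<^sup>2" for t
  have h_pos: "\<bar>t - t0\<bar> < r" if "h t > 0" for t
  proof (rule ccontr)
    assume "\<not> \<bar>t - t0\<bar> < r"
    then have "r * r \<le> \<bar>t - t0\<bar> * \<bar>t - t0\<bar>" using r by (intro mult_mono) auto
    moreover have "h t = r * r - \<bar>t - t0\<bar> * \<bar>t - t0\<bar>" by (simp add: h_def algebra_simps)
    ultimately show False using that by simp
  qed
  have der: "(\<eta> has_real_derivative 2 * max 0 (h t) * (2 * t0 - 2 * t)) (at t)" for t
  proof -
    have "(h has_real_derivative 2 * t0 - 2 * t) (at t)"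
      unfolding h_def by (auto intro!: derivative_eq_intros)
    from DERIV_chain2[OF max_zero_square_derivative this] show ?thesis unfolding \<eta>_def .
  qed
  have "\<eta> 0 = 0" "\<eta> T = 0"
    using h_pos[of 0] h_pos[of T] r by (force simp: \<eta>_def max_def)+
  moreover have "continuous_on UNIV (\<lambda>t. 2 * max 0 (h t) * (2 * t0 - 2 * t))"
    unfolding h_def by (intro continuous_intros)
  ultimately have "integral {0..T} (\<lambda>t. \<eta> t * g t) = 0"
    using int[OF der] by blast
  then have "integral {0..T} (\<lambda>t. \<eta> t * G t) = 0"
    unfolding G_def by (simp flip: mult.assoc)
  moreover have "continuous_on {0..T} (\<lambda>t. \<eta> t * G t)"
    unfolding \<eta>_def h_def by (intro continuous_intros G)
  moreover have "\<eta> t * G t \<ge> 0" if "t \<in> {0..T}" for t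
  proof (cases "h t > 0")
    case True
    then have "G t > 0" using Gd[OF that] h_pos[OF True] r by (auto simp: dist_real_def)
    then show ?thesis by (simp add: \<eta>_def)
  qed (simp add: \<eta>_def max_def)
  ultimately have "\<eta> t0 * G t0 = 0"
    using t0 by (subst (asm) integral_eq_0_iff) auto
  moreover have "\<eta> t0 > 0" using r by (simp add: \<eta>_def h_def max_def)
  ultimately show False using G0 by simp
qed

section \<open>The variation of the action\<close>

text \<open>Joint continuity in the variation parameter and time, in the norm \<open>N\<close>. The
  increment splits as \<open>(c t - c t0) + r *\<^sub>R (d t - d t0) + (r - r0) *\<^sub>R d
  t0\<close>.\<close>

lemma C0_curve_line_tendsto:
  assumes V: "subspace V" and N: "norm_on V N" and D: "modeled_on D V"
    and c: "C0_curve_in T N D c" and d: "C0_curve_in T N V d" and t0: "t0 \<in> {0..T}"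
  shows "((\<lambda>(r, t). N (c t + r *\<^sub>R d t - (c t0 + r0 *\<^sub>R d t0))) \<longlongrightarrow> 0)
      (at (r0, t0) within UNIV \<times> {0..T})"
proof -
  let ?F = "at (r0, t0) within UNIV \<times> {0..T}"
  have N0: "N 0 = 0" using norm_on_zero[OF N subspace_0[OF V]] .
  have lim: "((\<lambda>z. N (k (snd z) - k t0)) \<longlongrightarrow> 0) ?F"
    if "C0_curve_in T N E k" for k E
  proof -
    \<comment> \<open>The limit at \<open>t0\<close> omits the point itself, yet
      \<open>snd z\<close> may equal \<open>t0\<close>; \<open>N 0 = 0\<close> upgrades the limit to
      continuity, which can be composed.\<close>
    have "continuous (at t0 within {0..T}) (\<lambda>s. N (k s - k t0))"
      using that t0 N0 unfolding C0_curve_in_def continuous_within by simp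
    moreover have "(snd \<longlongrightarrow> t0) ?F"
      using tendsto_snd[OF tendsto_ident_at, of "(r0, t0)"] by simp
    moreover have "eventually (\<lambda>z. snd z \<in> {0..T}) ?F"
      unfolding eventually_at_filter by (auto intro!: always_eventually)
    ultimately have "((\<lambda>z. N (k (snd z) - k t0)) \<longlongrightarrow> N (k t0 - k t0)) ?F"
      using continuous_within_tendsto_compose[of t0 "{0..T}" "\<lambda>s. N (k s - k t0)" snd] by blast
    then show ?thesis using N0 by simp
  qed
  let ?B = "\<lambda>z. N (c (snd z) - c t0) + \<bar>fst z\<bar> * N (d (snd z) - d t0) + \<bar>fst z - r0\<bar> * N (d t0)"
  have "eventually (\<lambda>z. norm (case z of (r, t) \<Rightarrow> N (c t + r *\<^sub>R d t - (c t0 + r0 *\<^sub>R d t0))) \<le> ?B z) ?F"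
    unfolding eventually_at_filter
  proof (intro always_eventually allI impI)
    fix z :: "real \<times> real" assume "z \<in> UNIV \<times> {0..T}"
    then obtain r t where z: "z = (r, t)" and t: "t \<in> {0..T}" by auto
    have mem: "c t - c t0 \<in> V" "d t \<in> V" "d t0 \<in> V"
      using c d t t0 modeled_on_diff[OF D V] unfolding C0_curve_in_def by blast+
    have mem': "r *\<^sub>R (d t - d t0) \<in> V" "(r - r0) *\<^sub>R d t0 \<in> V" "d t - d t0 \<in> V"
      using mem V by (auto intro: subspace_scale subspace_diff)
    have eq: "c t + r *\<^sub>R d t - (c t0 + r0 *\<^sub>R d t0)
        = (c t - c t0) + (r *\<^sub>R (d t - d t0) + (r - r0) *\<^sub>R d t0)"
      by (simp add: algebra_simps)
    have "N ((c t - c t0) + (r *\<^sub>R (d t - d t0) + (r - r0) *\<^sub>R d t0))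
        \<le> N (c t - c t0) + (N (r *\<^sub>R (d t - d t0)) + N ((r - r0) *\<^sub>R d t0))"
      using norm_on_triangle[OF N mem(1) subspace_add[OF V mem'(1,2)]]
        norm_on_triangle[OF N mem'(1,2)] by simp
    moreover have "0 \<le> N ((c t - c t0) + (r *\<^sub>R (d t - d t0) + (r - r0) *\<^sub>R d t0))"
      by (intro norm_on_nonneg[OF N] subspace_add[OF V] mem mem')
    ultimately show "norm (case z of (r, t) \<Rightarrow> N (c t + r *\<^sub>R d t - (c t0 + r0 *\<^sub>R d t0))) \<le> ?B z"
      unfolding z prod.case eq norm_on_scale[OF N mem'(3)] norm_on_scale[OF N mem(3)] by simp
  qed
  moreover have "(?B \<longlongrightarrow> 0 + \<bar>r0\<bar> * 0 + \<bar>r0 - r0\<bar> * N (d t0)) ?F"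
    using tendsto_fst[OF tendsto_ident_at, of "(r0, t0)"]
    by (intro tendsto_intros lim[OF c] lim[OF d]) auto
  then have "(?B \<longlongrightarrow> 0) ?F" by simp
  ultimately show ?thesis
    by (rule Lim_null_comparison)
qed

section \<open>The Hamiltonian and the action along varied curves\<close>

locale smooth_hamiltonian_system =
  fixes T :: real
    and V1 D1 :: "'a::real_normed_vector set" and N1 :: "'a \<Rightarrow> real"
    and V2 D2 :: "('a \<Rightarrow>\<^sub>L real) set" and N2 :: "('a \<Rightarrow>\<^sub>L real) \<Rightarrow> real"
    and H :: "real \<Rightarrow> 'a \<Rightarrow> ('a \<Rightarrow>\<^sub>L real) \<Rightarrow> real"
    and D\<phi>H :: "real \<Rightarrow> 'a \<Rightarrow> ('a \<Rightarrow>\<^sub>L real) \<Rightarrow> ('a \<Rightarrow>\<^sub>L real)"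
    and D\<pi>H :: "real \<Rightarrow> 'a \<Rightarrow> ('a \<Rightarrow>\<^sub>L real) \<Rightarrow> 'a"
  assumes V1: "subspace V1" and D1: "modeled_on D1 V1" and N1: "norm_on V1 N1"
    and V2: "subspace V2" and D2: "modeled_on D2 V2" and N2: "norm_on V2 N2"
    and T: "T > 0"
    and smooth: "smooth_hamiltonian T V1 N1 D1 V2 N2 D2 H"
    and D\<phi>H: "\<And>t x p v. t \<in> {0..T} \<Longrightarrow> x \<in> D1 \<Longrightarrow> p \<in> D2 \<Longrightarrow> v \<in> V1 \<Longrightarrow>
           ((\<lambda>\<epsilon>. H t (x + \<epsilon> *\<^sub>R v) p) has_real_derivative blinfun_apply (D\<phi>H t x p) v) (at 0)"
    and D\<pi>H: "\<And>t x p q. t \<in> {0..T} \<Longrightarrow> x \<in> D1 \<Longrightarrow> p \<in> D2 \<Longrightarrow> q \<in> V2 \<Longrightarrow>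
           ((\<lambda>\<epsilon>. H t x (p + \<epsilon> *\<^sub>R q)) has_real_derivative blinfun_apply q (D\<pi>H t x p)) (at 0)"
begin

text \<open>\<open>D\<phi>H\<close> and \<open>D\<pi>H\<close> are given only through directional
  derivatives. Identifying their pairings with values of the total derivative \<open>L\<close>
  transfers its operator-norm continuity to \<open>h'\<close>, as differentiation under the integral
  requires.\<close>

lemma hamiltonian_along_curve:
  assumes c: "(\<phi>, \<pi>) \<in> phase_curves T N1 D1 N2 D2"
    and d: "(\<delta>\<phi>, \<delta>\<pi>) \<in> phase_curves T N1 V1 N2 V2"
  defines "h \<equiv> \<lambda>r t. H t (\<phi> t + r *\<^sub>R \<delta>\<phi> t) (\<pi> t + r *\<^sub>R \<delta>\<pi> t)"
    and "h' \<equiv> \<lambda>r t. blinfun_apply (D\<phi>H t (\<phi> t + r *\<^sub>R \<delta>\<phi> t) (\<pi> t + r *\<^sub>R \<delta>\<pi> t)) (\<delta>\<phi> t)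
        + blinfun_apply (\<delta>\<pi> t) (D\<pi>H t (\<phi> t + r *\<^sub>R \<delta>\<phi> t) (\<pi> t + r *\<^sub>R \<delta>\<pi> t))"
  shows "t \<in> {0..T} \<Longrightarrow> ((\<lambda>r. h r t) has_real_derivative h' r t) (at r)"
    and "continuous_on (UNIV \<times> {0..T}) (\<lambda>(r, t). h r t)"
    and "continuous_on (UNIV \<times> {0..T}) (\<lambda>(r, t). h' r t)"
proof -
  let ?V = "(UNIV :: real set) \<times> V1 \<times> V2"
  let ?N = "\<lambda>(s :: real, x, p). \<bar>s\<bar> + N1 x + N2 p"
  let ?S = "{0..T} \<times> D1 \<times> D2"
  let ?f = "\<lambda>(t, x, p). H t x p"
  have V: "subspace ?V" using subspace_UNIV_times[OF V1 V2] .
  have N: "norm_on ?V ?N" using norm_on_prod[OF N1 N2] .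
  have diff: "x - y \<in> ?V" if "x \<in> ?S" "y \<in> ?S" for x y
    using that modeled_on_diff[OF D1 V1] modeled_on_diff[OF D2 V2] by auto
  obtain L where
    lin: "\<And>x a b v w. x \<in> ?S \<Longrightarrow> v \<in> ?V \<Longrightarrow> w \<in> ?V \<Longrightarrow> L x (a *\<^sub>R v + b *\<^sub>R w) = a *\<^sub>R L x v + b *\<^sub>R L x w"
    and bnd: "\<And>x. x \<in> ?S \<Longrightarrow> \<exists>C\<ge>0. \<forall>v\<in>?V. norm (L x v) \<le> C * ?N v"
    and rem: "\<And>x e. x \<in> ?S \<Longrightarrow> e > 0 \<Longrightarrow>
       \<exists>d>0. \<forall>y\<in>?S. ?N (y - x) < d \<longrightarrow> norm (?f y - ?f x - L x (y - x)) \<le> e * ?N (y - x)"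
    and lip: "\<And>x. x \<in> ?S \<Longrightarrow> \<exists>C\<ge>0. \<exists>d>0. \<forall>y\<in>?S. ?N (y - x) < d \<longrightarrow>
       (\<forall>v\<in>?V. norm (L y v - L x v) \<le> C * ?N (y - x) * ?N v)"
    using smooth_wrt_first_derivative[OF V N smooth[unfolded smooth_hamiltonian_def] diff] by blast
  have lin1: "L x (a *\<^sub>R v) = a * L x v" if "x \<in> ?S" "v \<in> ?V" for x v a
    using lin[OF that that(2), of a 0] by simp
  have L_eq: "L (t, x, p) (0, v, q) = blinfun_apply (D\<phi>H t x p) v + blinfun_apply q (D\<pi>H t x p)"
    if t: "t \<in> {0..T}" and x: "x \<in> D1" and p: "p \<in> D2" and v: "v \<in> V1" and q: "q \<in> V2" for t x p v q
  proof -
    have S: "(t, x, p) \<in> ?S" using that by auto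
    have zero: "0 \<in> V1" "0 \<in> V2" using V1 V2 by (auto intro: subspace_0)
    \<comment> \<open>The direction has no time component, so the line stays in the domain even when
      \<open>t\<close> is 0 or \<open>T\<close>.\<close>
    have line: "((\<lambda>r. ?f ((t, x, p) + r *\<^sub>R (0, v', q'))) has_real_derivative L (t, x, p) (0, v', q')) (at 0)"
      if v': "v' \<in> V1" and q': "q' \<in> V2" for v' q'
    proof (rule first_derivative_along_line[OF N])
      show "(0, v', q') \<in> ?V" using v' q' by simp
      show "(t, x, p) + r *\<^sub>R (0, v', q') \<in> ?S" for r
        using t modeled_on_add[OF D1 V1 x subspace_scale[OF V1 v']]
          modeled_on_add[OF D2 V2 p subspace_scale[OF V2 q']] by simp
      show "L (t, x, p) (r *\<^sub>R (0, v', q')) = r * L (t, x, p) (0, v', q')" for r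
        using lin1[OF S] v' q' by blast
      show "(t, x, p) = (t, x, p) + 0 *\<^sub>R (0, v', q')" by simp
    qed (rule rem[OF S])
    have 1: "L (t, x, p) (0, v, 0) = blinfun_apply (D\<phi>H t x p) v"
      using DERIV_unique[OF _ D\<phi>H[OF t x p v]] line[OF v zero(2)] by simp
    have 2: "L (t, x, p) (0, 0, q) = blinfun_apply q (D\<pi>H t x p)"
      using DERIV_unique[OF _ D\<pi>H[OF t x p q]] line[OF zero(1) q] by simp
    show ?thesis
      using lin[OF S, of "(0, v, 0)" "(0, 0, q)" 1 1] v q zero 1 2 by simp
  qed
  have cD: "\<phi> t \<in> D1" "\<pi> t \<in> D2" "\<delta>\<phi> t \<in> V1" "\<delta>\<pi> t \<in> V2" if "t \<in> {0..T}" for t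
    using c d that unfolding phase_curves_def C0_curve_in_def by auto
  define X where "X z = (snd z, \<phi> (snd z) + fst z *\<^sub>R \<delta>\<phi> (snd z), \<pi> (snd z) + fst z *\<^sub>R \<delta>\<pi> (snd z))" for z
  define W where "W z = (0 :: real, \<delta>\<phi> (snd z), \<delta>\<pi> (snd z))" for z :: "real \<times> real"
  have h_X: "h (fst z) (snd z) = ?f (X z)" for z unfolding h_def X_def by simp
  have XS: "X z \<in> ?S" if "z \<in> UNIV \<times> {0..T}" for z
    using that cD modeled_on_add[OF D1 V1 _ subspace_scale[OF V1]]
      modeled_on_add[OF D2 V2 _ subspace_scale[OF V2]] unfolding X_def by auto
  have WV: "W z \<in> ?V" if "z \<in> UNIV \<times> {0..T}" for z
    using that cD unfolding W_def by auto
  have h'_L: "h' (fst z) (snd z) = L (X z) (W z)" if "z \<in> UNIV \<times> {0..T}" for z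
    using L_eq XS[OF that] WV[OF that] unfolding X_def W_def h'_def by auto
  have evI: "eventually P (at z within UNIV \<times> {0..T})"
    if "\<And>w. w \<in> UNIV \<times> {0..T} \<Longrightarrow> P w" for P and z :: "real \<times> real"
    unfolding eventually_at_filter using that by (auto intro!: always_eventually)
  have evX: "\<forall>\<^sub>F w in at z within UNIV \<times> {0..T}. X w \<in> ?S" for z
    by (rule evI) (rule XS)
  have evW: "\<forall>\<^sub>F w in at z within UNIV \<times> {0..T}. W w \<in> ?V" for z
    by (rule evI) (rule WV)
  have Xlim: "((\<lambda>w. ?N (X w - X z)) \<longlongrightarrow> 0) (at z within UNIV \<times> {0..T})"
    if z: "z \<in> UNIV \<times> {0..T}" for z
  proof -
    obtain r0 t0 where zd: "z = (r0, t0)" and t0: "t0 \<in> {0..T}" using z by auto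
    have "((\<lambda>w. \<bar>snd w - t0\<bar> + (case w of (r, t) \<Rightarrow> N1 (\<phi> t + r *\<^sub>R \<delta>\<phi> t - (\<phi> t0 + r0 *\<^sub>R \<delta>\<phi> t0)))
        + (case w of (r, t) \<Rightarrow> N2 (\<pi> t + r *\<^sub>R \<delta>\<pi> t - (\<pi> t0 + r0 *\<^sub>R \<delta>\<pi> t0))))
        \<longlongrightarrow> \<bar>t0 - t0\<bar> + 0 + 0) (at (r0, t0) within UNIV \<times> {0..T})"
      using c d t0 tendsto_snd[OF tendsto_ident_at, of "(r0, t0)"] unfolding phase_curves_def
      by (intro tendsto_intros C0_curve_line_tendsto[OF V1 N1 D1] C0_curve_line_tendsto[OF V2 N2 D2]) auto
    then show ?thesis by (simp add: zd X_def split_beta)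
  qed
  \<comment> \<open>Each model space is affine over itself, so the line lemma also applies to the
    variations, with the zero curve as direction.\<close>
  have V1self: "modeled_on V1 V1" and V2self: "modeled_on V2 V2"
    unfolding modeled_on_def by (auto intro!: exI[of _ 0])
  have Wlim: "((\<lambda>w. ?N (W w - W z)) \<longlongrightarrow> 0) (at z within UNIV \<times> {0..T})"
    if z: "z \<in> UNIV \<times> {0..T}" for z
  proof -
    obtain r0 t0 where zd: "z = (r0, t0)" and t0: "t0 \<in> {0..T}" using z by auto
    have zero: "C0_curve_in T N1 V1 (\<lambda>_. 0)" "C0_curve_in T N2 V2 (\<lambda>_. 0)"
      unfolding C0_curve_in_def using V1 V2 N1 N2 by (auto simp: subspace_0 norm_on_zero)
    have "((\<lambda>w. (case w of (r, t) \<Rightarrow> N1 (\<delta>\<phi> t + r *\<^sub>R 0 - (\<delta>\<phi> t0 + r0 *\<^sub>R 0)))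
        + (case w of (r, t) \<Rightarrow> N2 (\<delta>\<pi> t + r *\<^sub>R 0 - (\<delta>\<pi> t0 + r0 *\<^sub>R 0))))
        \<longlongrightarrow> 0 + 0) (at (r0, t0) within UNIV \<times> {0..T})"
      using d t0 zero unfolding phase_curves_def
      by (intro tendsto_intros C0_curve_line_tendsto[OF V1 N1 V1self, where d = "\<lambda>_. 0"]
          C0_curve_line_tendsto[OF V2 N2 V2self, where d = "\<lambda>_. 0"]) auto
    then show ?thesis by (simp add: zd W_def split_beta)
  qed
  show "continuous_on (UNIV \<times> {0..T}) (\<lambda>(r, t). h r t)"
    unfolding continuous_on_def
  proof
    fix z assume z: "z \<in> (UNIV :: real set) \<times> {0..T}"
    have "((\<lambda>w. ?f (X w)) \<longlongrightarrow> ?f (X z)) (at z within UNIV \<times> {0..T})"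
    proof (rule first_derivative_imp_tendsto[where f = ?f and L = L and x = "X z" and X = X
          and V = ?V and N = ?N and S = ?S])
      show "\<exists>C\<ge>0. \<forall>v\<in>?V. norm (L (X z) v) \<le> C * ?N v" by (rule bnd[OF XS[OF z]])
      show "\<exists>d>0. \<forall>y\<in>?S. ?N (y - X z) < d \<longrightarrow>
          norm (?f y - ?f (X z) - L (X z) (y - X z)) \<le> e * ?N (y - X z)" if "e > 0" for e
        using rem[OF XS[OF z] that] .
      show "y - X z \<in> ?V" if "y \<in> ?S" for y by (rule diff[OF that XS[OF z]])
    qed (rule evX Xlim[OF z])+
    then show "((\<lambda>(r, t). h r t) \<longlongrightarrow> (case z of (r, t) \<Rightarrow> h r t)) (at z within UNIV \<times> {0..T})"
      by (simp add: case_prod_beta' h_X)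
  qed
  show "continuous_on (UNIV \<times> {0..T}) (\<lambda>(r, t). h' r t)"
    unfolding continuous_on_def
  proof
    fix z assume z: "z \<in> (UNIV :: real set) \<times> {0..T}"
    have "L (X z) (v - w) = L (X z) v - L (X z) w" if "v \<in> ?V" "w \<in> ?V" for v w
      using lin[OF XS[OF z] that, of 1 "-1"] by simp
    then have "((\<lambda>w. L (X w) (W w)) \<longlongrightarrow> L (X z) (W z)) (at z within UNIV \<times> {0..T})"
      by (intro locally_lipschitz_operator_tendsto[where L = L and X = X and W = W and x = "X z" and w = "W z",
            OF V N bnd[OF XS[OF z]] _ lip[OF XS[OF z]] WV[OF z] evX evW Xlim[OF z] Wlim[OF z]])
    then have "((\<lambda>w. h' (fst w) (snd w)) \<longlongrightarrow> L (X z) (W z)) (at z within UNIV \<times> {0..T})"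
      by (rule tendsto_cong[THEN iffD1, rotated]) (rule evI, simp add: h'_L)
    then show "((\<lambda>(r, t). h' r t) \<longlongrightarrow> (case z of (r, t) \<Rightarrow> h' r t)) (at z within UNIV \<times> {0..T})"
      using h'_L[OF z] by (simp add: case_prod_beta')
  qed
  assume t: "t \<in> {0..T}"
  have "((\<lambda>r. ?f ((t, \<phi> t, \<pi> t) + r *\<^sub>R (0, \<delta>\<phi> t, \<delta>\<pi> t))) has_real_derivative L (X (r, t)) (0, \<delta>\<phi> t, \<delta>\<pi> t)) (at r)"
  proof (rule first_derivative_along_line[OF N])
    have S: "X (r, t) \<in> ?S" using XS[of "(r, t)"] t by simp
    show "L (X (r, t)) (c *\<^sub>R (0, \<delta>\<phi> t, \<delta>\<pi> t)) = c * L (X (r, t)) (0, \<delta>\<phi> t, \<delta>\<pi> t)" for c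
      using lin1[OF S] cD[OF t] by blast
    show "\<exists>d>0. \<forall>y\<in>?S. ?N (y - X (r, t)) < d \<longrightarrow>
         norm (?f y - ?f (X (r, t)) - L (X (r, t)) (y - X (r, t))) \<le> e * ?N (y - X (r, t))"
      if "e > 0" for e
      using rem[OF S that] .
    show "(0, \<delta>\<phi> t, \<delta>\<pi> t) \<in> ?V" using cD[OF t] by simp
    show "(t, \<phi> t, \<pi> t) + r *\<^sub>R (0, \<delta>\<phi> t, \<delta>\<pi> t) \<in> ?S" for r
      using XS[of "(r, t)"] t unfolding X_def by simp
    show "X (r, t) = (t, \<phi> t, \<pi> t) + r *\<^sub>R (0, \<delta>\<phi> t, \<delta>\<pi> t)" by (simp add: X_def)
  qed
  then show "((\<lambda>r. h r t) has_real_derivative h' r t) (at r)"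
    using h'_L[of "(r, t)"] t by (simp add: h_def W_def)
qed

text \<open>The term at 0 is kept because \<open>\<delta>\<phi> 0 = 0\<close> is not imposed:
  continuity of \<open>g\<close> will also be wanted for constant variations.\<close>

lemma action_variation:
  assumes c: "(\<phi>, \<pi>) \<in> phase_curves T N1 D1 N2 D2"
    and d: "(\<delta>\<phi>, \<delta>\<pi>) \<in> phase_curves T N1 V1 N2 V2"
  defines "g \<equiv> \<lambda>t. blinfun_apply (\<delta>\<pi> t) (velocity T \<phi> t - D\<pi>H t (\<phi> t) (\<pi> t))
      - blinfun_apply (velocity T \<pi> t + D\<phi>H t (\<phi> t) (\<pi> t)) (\<delta>\<phi> t)"
  shows "continuous_on {0..T} g"
    and "has_action_variation T H \<phi> \<pi> \<delta>\<phi> \<delta>\<pi>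
      (blinfun_apply (\<pi> T) (\<delta>\<phi> T) - blinfun_apply (\<pi> 0) (\<delta>\<phi> 0) + integral {0..T} g)"
proof -
  define h where "h r t = H t (\<phi> t + r *\<^sub>R \<delta>\<phi> t) (\<pi> t + r *\<^sub>R \<delta>\<pi> t)" for r t
  define h' where "h' r t = blinfun_apply (D\<phi>H t (\<phi> t + r *\<^sub>R \<delta>\<phi> t) (\<pi> t + r *\<^sub>R \<delta>\<pi> t)) (\<delta>\<phi> t)
        + blinfun_apply (\<delta>\<pi> t) (D\<pi>H t (\<phi> t + r *\<^sub>R \<delta>\<phi> t) (\<pi> t + r *\<^sub>R \<delta>\<pi> t))" for r t
  note ham = hamiltonian_along_curve[OF c d, folded h_def h'_def]
  have C1: "C1_curve T \<phi>" "C1_curve T \<pi>" "C1_curve T \<delta>\<phi>" "C1_curve T \<delta>\<pi>"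
    using c d unfolding phase_curves_def by auto
  note cont = C1[THEN C1_curve_continuous] and vcont = C1[THEN C1_curve_velocity_continuous]
  have cont2: "continuous_on (UNIV \<times> {0..T}) (\<lambda>z. k (snd z))"
    if "continuous_on {0..T} k" for k :: "real \<Rightarrow> 'b::topological_space"
    using that by (rule continuous_on_compose2) (auto intro: continuous_on_snd)
  have section_cont: "continuous_on {0..T} (k r)"
    if "continuous_on (UNIV \<times> {0..T}) (\<lambda>(r, t). k r t)" for k :: "real \<Rightarrow> real \<Rightarrow> real" and r
    using continuous_on_compose2[OF that, of "{0..T}" "\<lambda>t. (r, t)"]
    by (force intro: continuous_on_Pair continuous_on_const continuous_on_id)
  define F where "F r t = blinfun_apply (\<pi> t + r *\<^sub>R \<delta>\<pi> t) (velocity T \<phi> t + r *\<^sub>R velocity T \<delta>\<phi> t) - h r t"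
    for r t
  define F' where "F' r t = blinfun_apply (\<delta>\<pi> t) (velocity T \<phi> t + r *\<^sub>R velocity T \<delta>\<phi> t)
      + blinfun_apply (\<pi> t + r *\<^sub>R \<delta>\<pi> t) (velocity T \<delta>\<phi> t) - h' r t" for r t
  have F_der: "((\<lambda>r. F r t) has_real_derivative F' r t) (at r)" if t: "t \<in> {0..T}" for r t
  proof -
    have "((\<lambda>r. blinfun_apply (\<pi> t + r *\<^sub>R \<delta>\<pi> t) (velocity T \<phi> t + r *\<^sub>R velocity T \<delta>\<phi> t))
        has_vector_derivative
        blinfun_apply (\<pi> t + r *\<^sub>R \<delta>\<pi> t) (velocity T \<delta>\<phi> t)
        + blinfun_apply (\<delta>\<pi> t) (velocity T \<phi> t + r *\<^sub>R velocity T \<delta>\<phi> t)) (at r)"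
      by (rule blinfun.has_vector_derivative) (auto intro!: derivative_eq_intros simp: has_vector_derivative_def)
    from DERIV_diff[OF this[folded has_real_derivative_iff_has_vector_derivative] ham(1)[OF t]]
    show ?thesis unfolding F_def F'_def by (simp add: add.commute)
  qed
  have F_cont: "continuous_on {0..T} (F r)" for r
    unfolding F_def
    by (intro continuous_intros blinfun.continuous_on cont vcont section_cont[OF ham(2)])
  have F'_cont: "continuous_on (UNIV \<times> {0..T}) (\<lambda>(r, t). F' r t)"
    unfolding F'_def case_prod_beta'
    by (intro continuous_intros blinfun.continuous_on cont[THEN cont2] vcont[THEN cont2] ham(3)[unfolded case_prod_beta'])
  have action_F: "action T H (\<lambda>t. \<phi> t + r *\<^sub>R \<delta>\<phi> t) (\<lambda>t. \<pi> t + r *\<^sub>R \<delta>\<pi> t) = integral {0..T} (F r)" for r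
    unfolding action_def
  proof (rule integral_cong)
    fix t assume t: "t \<in> {0..T}"
    have "((\<lambda>t. \<phi> t + r *\<^sub>R \<delta>\<phi> t) has_vector_derivative velocity T \<phi> t + r *\<^sub>R velocity T \<delta>\<phi> t)
        (at t within {0..T})"
      by (intro has_vector_derivative_add C1_curve_has_vector_derivative C1 t
          bounded_linear.has_vector_derivative[OF bounded_linear_scaleR_right])
    then have "velocity T (\<lambda>t. \<phi> t + r *\<^sub>R \<delta>\<phi> t) t = velocity T \<phi> t + r *\<^sub>R velocity T \<delta>\<phi> t"
      by (rule velocity_eq[OF T t])
    then show "blinfun_apply (\<pi> t + r *\<^sub>R \<delta>\<pi> t) (velocity T (\<lambda>t. \<phi> t + r *\<^sub>R \<delta>\<phi> t) t)
        - H t (\<phi> t + r *\<^sub>R \<delta>\<phi> t) (\<pi> t + r *\<^sub>R \<delta>\<pi> t) = F r t"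
      by (simp add: F_def h_def)
  qed
  \<comment> \<open>The Leibniz rule, resting on the joint continuity of \<open>F'\<close>.\<close>
  have "((\<lambda>r. integral (cbox 0 T) (F r)) has_field_derivative integral (cbox 0 T) (F' 0)) (at 0 within UNIV)"
    by (rule leibniz_rule_field_derivative)
      (use F_der F_cont F'_cont in \<open>auto intro: integrable_continuous_real\<close>)
  then have var: "has_action_variation T H \<phi> \<pi> \<delta>\<phi> \<delta>\<pi> (integral {0..T} (F' 0))"
    unfolding has_action_variation_def action_F by simp
  \<comment> \<open>By the product rule this is the time derivative of
    \<open>blinfun_apply (\<pi> t) (\<delta>\<phi> t)\<close>; splitting it off is the integration
    by parts.\<close>
  let ?p = "\<lambda>t. blinfun_apply (\<pi> t) (velocity T \<delta>\<phi> t) + blinfun_apply (velocity T \<pi> t) (\<delta>\<phi> t)"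
  have F'_g: "F' 0 t = g t + ?p t" for t
    by (simp add: F'_def h'_def g_def blinfun.add_left blinfun.diff_right)
  have p_cont: "continuous_on {0..T} ?p"
    by (intro continuous_intros blinfun.continuous_on cont vcont)
  \<comment> \<open>Continuity is obtained for the pairings as a whole: no continuity of
    \<open>D\<phi>H\<close> or \<open>D\<pi>H\<close> along the curve in the ambient norms has been
    established.\<close>
  have "continuous_on {0..T} (\<lambda>t. F' 0 t - ?p t)"
    by (intro continuous_intros section_cont[OF F'_cont] p_cont)
  then show g_cont: "continuous_on {0..T} g" by (simp add: F'_g)
  have "(?p has_integral blinfun_apply (\<pi> T) (\<delta>\<phi> T) - blinfun_apply (\<pi> 0) (\<delta>\<phi> 0)) {0..T}"
    using T by (intro fundamental_theorem_of_calculus blinfun.has_vector_derivative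
        C1_curve_has_vector_derivative C1) auto
  then have "integral {0..T} (F' 0)
      = blinfun_apply (\<pi> T) (\<delta>\<phi> T) - blinfun_apply (\<pi> 0) (\<delta>\<phi> 0) + integral {0..T} g"
    using integral_add[OF integrable_continuous_real[OF g_cont] integrable_continuous_real[OF p_cont]]
    by (simp add: F'_g integral_unique cong: integral_cong)
  with var show "has_action_variation T H \<phi> \<pi> \<delta>\<phi> \<delta>\<pi>
      (blinfun_apply (\<pi> T) (\<delta>\<phi> T) - blinfun_apply (\<pi> 0) (\<delta>\<phi> 0) + integral {0..T} g)"
    by simp
qed

end

section \<open>Density of the model spaces and the equivalence\<close>

lemma dense_zero_imp_zero:
  fixes k :: "'a::real_normed_vector \<Rightarrow> real"
  assumes "bounded_linear k" "closure V = UNIV" "\<And>v. v \<in> V \<Longrightarrow> k v = 0"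
  shows "k v = 0"
  using continuous_constant_on_closure[of V k 0 v] assms linear_continuous_on by auto

theorem mainTheorem4:
  fixes T :: real
    and V1 D1 :: "'a::banach set" and N1 :: "'a \<Rightarrow> real"
    and V2 D2 :: "('a \<Rightarrow>\<^sub>L real) set" and N2 :: "('a \<Rightarrow>\<^sub>L real) \<Rightarrow> real"
    and H :: "real \<Rightarrow> 'a \<Rightarrow> ('a \<Rightarrow>\<^sub>L real) \<Rightarrow> real"
    and D\<phi>H :: "real \<Rightarrow> 'a \<Rightarrow> ('a \<Rightarrow>\<^sub>L real) \<Rightarrow> ('a \<Rightarrow>\<^sub>L real)"
    and D\<pi>H :: "real \<Rightarrow> 'a \<Rightarrow> ('a \<Rightarrow>\<^sub>L real) \<Rightarrow> 'a"
    and \<phi>0 :: 'a and \<pi>1 :: "'a \<Rightarrow> ('a \<Rightarrow>\<^sub>L real)"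
    and \<phi> :: "real \<Rightarrow> 'a" and \<pi> :: "real \<Rightarrow> 'a \<Rightarrow>\<^sub>L real"
  assumes "reflexive_space TYPE('a)"
    and "subspace V1" and "closure V1 = UNIV" and "modeled_on D1 V1"
    and "norm_on V1 N1" and "continuous_inclusion V1 N1"
    and "subspace V2" and "closure V2 = UNIV" and "modeled_on D2 V2"
    and "norm_on V2 N2" and "continuous_inclusion V2 N2"
    and "T > 0"
    and "smooth_hamiltonian T V1 N1 D1 V2 N2 D2 H"
    and "\<And>t x p v. t \<in> {0..T} \<Longrightarrow> x \<in> D1 \<Longrightarrow> p \<in> D2 \<Longrightarrow> v \<in> V1 \<Longrightarrow>
           ((\<lambda>\<epsilon>. H t (x + \<epsilon> *\<^sub>R v) p) has_real_derivative blinfun_apply (D\<phi>H t x p) v) (at 0)"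
    and "\<And>t x p q. t \<in> {0..T} \<Longrightarrow> x \<in> D1 \<Longrightarrow> p \<in> D2 \<Longrightarrow> q \<in> V2 \<Longrightarrow>
           ((\<lambda>\<epsilon>. H t x (p + \<epsilon> *\<^sub>R q)) has_real_derivative blinfun_apply q (D\<pi>H t x p)) (at 0)"
    and "\<phi>0 \<in> D1"
    and "\<pi>1 \<in> D1 \<rightarrow> D2"
    and "(\<phi>, \<pi>) \<in> phase_curves_from T N1 D1 N2 D2 \<phi>0"
  shows "(\<forall>(\<delta>\<phi>, \<delta>\<pi>) \<in> partial_variations T N1 V1 N2 V2.
            has_action_variation T H \<phi> \<pi> \<delta>\<phi> \<delta>\<pi> (blinfun_apply (\<pi>1 (\<phi> T)) (\<delta>\<phi> T)))
         \<longleftrightarrow>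
         ((\<forall>t\<in>{0<..<T}.
             (\<phi> has_vector_derivative D\<pi>H t (\<phi> t) (\<pi> t)) (at t) \<and>
             (\<pi> has_vector_derivative - D\<phi>H t (\<phi> t) (\<pi> t)) (at t)) \<and>
          \<phi> 0 = \<phi>0 \<and> \<pi> T = \<pi>1 (\<phi> T))"
proof -
  interpret smooth_hamiltonian_system T V1 D1 N1 V2 D2 N2 H D\<phi>H D\<pi>H
    using assms by unfold_locales
  have c: "(\<phi>, \<pi>) \<in> phase_curves T N1 D1 N2 D2" and init: "\<phi> 0 = \<phi>0"
    using assms(18) unfolding phase_curves_from_def by auto
  have C1: "C1_curve T \<phi>" "C1_curve T \<pi>" using c unfolding phase_curves_def by auto
  \<comment> \<open>\<open>ey\<close> and \<open>ep\<close> are the residuals of Hamilton's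
    equations, the first in the space and the second in its dual.\<close>
  define ey where "ey t = velocity T \<phi> t - D\<pi>H t (\<phi> t) (\<pi> t)" for t
  define ep where "ep t = velocity T \<pi> t + D\<phi>H t (\<phi> t) (\<pi> t)" for t
  note variation = action_variation[OF c, folded ey_def ep_def]
  have eqs: "(\<forall>t\<in>{0<..<T}.
             (\<phi> has_vector_derivative D\<pi>H t (\<phi> t) (\<pi> t)) (at t) \<and>
             (\<pi> has_vector_derivative - D\<phi>H t (\<phi> t) (\<pi> t)) (at t))
      \<longleftrightarrow> (\<forall>t\<in>{0<..<T}. ey t = 0 \<and> ep t = 0)"
  proof (intro ball_cong refl conj_cong)
    fix t assume t: "t \<in> {0<..<T}"
    show "(\<phi> has_vector_derivative D\<pi>H t (\<phi> t) (\<pi> t)) (at t) \<longleftrightarrow> ey t = 0"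
      using C1_curve_interior_derivative[OF C1(1) t] vector_derivative_unique_at
      unfolding ey_def by fastforce
    show "(\<pi> has_vector_derivative - D\<phi>H t (\<phi> t) (\<pi> t)) (at t) \<longleftrightarrow> ep t = 0"
      using C1_curve_interior_derivative[OF C1(2) t] vector_derivative_unique_at
      unfolding ep_def by (metis add.commute add.right_inverse minus_unique)
  qed
  have "(\<forall>(\<delta>\<phi>, \<delta>\<pi>) \<in> partial_variations T N1 V1 N2 V2.
            has_action_variation T H \<phi> \<pi> \<delta>\<phi> \<delta>\<pi> (blinfun_apply (\<pi>1 (\<phi> T)) (\<delta>\<phi> T)))
         \<longleftrightarrow> (\<forall>t\<in>{0<..<T}. ey t = 0 \<and> ep t = 0) \<and> \<pi> T = \<pi>1 (\<phi> T)"
  proof (intro iffI)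
    assume *: "\<forall>(\<delta>\<phi>, \<delta>\<pi>) \<in> partial_variations T N1 V1 N2 V2.
            has_action_variation T H \<phi> \<pi> \<delta>\<phi> \<delta>\<pi> (blinfun_apply (\<pi>1 (\<phi> T)) (\<delta>\<phi> T))"
    define g where "g q v t = blinfun_apply q (ey t) - blinfun_apply (ep t) v" for q v t
    \<comment> \<open>Uniqueness of the derivative equates the assumed value of the variation with
      the computed one; \<open>\<eta> 0 = 0\<close> removes the term at 0.\<close>
    have scaled: "blinfun_apply (\<pi>1 (\<phi> T)) (\<eta> T *\<^sub>R v) =
        blinfun_apply (\<pi> T) (\<eta> T *\<^sub>R v) + integral {0..T} (\<lambda>t. \<eta> t * g q v t)"
      if der: "\<And>t. (\<eta> has_real_derivative \<eta>' t) (at t)" and cont: "continuous_on UNIV \<eta>'"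
        and "\<eta> 0 = 0" and v: "v \<in> V1" and q: "q \<in> V2" for \<eta> \<eta>' v q
    proof -
      let ?v = "\<lambda>t. \<eta> t *\<^sub>R v" and ?q = "\<lambda>t. \<eta> t *\<^sub>R q"
      have pc: "(?v, ?q) \<in> phase_curves T N1 V1 N2 V2"
        using scaled_vector_curve[OF T V1 N1 v der cont] scaled_vector_curve[OF T V2 N2 q der cont]
        unfolding phase_curves_def by simp
      then have "(?v, ?q) \<in> partial_variations T N1 V1 N2 V2"
        using \<open>\<eta> 0 = 0\<close> unfolding partial_variations_def by simp
      with * have var: "has_action_variation T H \<phi> \<pi> ?v ?q (blinfun_apply (\<pi>1 (\<phi> T)) (?v T))"
        by blast
      have eq: "blinfun_apply (?q t) (ey t) - blinfun_apply (ep t) (?v t) = \<eta> t * g q v t" for t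
        by (simp add: g_def blinfun.scaleR_left blinfun.scaleR_right algebra_simps)
      note var' = variation(2)[OF pc, unfolded eq]
      show ?thesis
        using var \<open>\<eta> 0 = 0\<close> var' unfolding has_action_variation_def
        by (auto dest: DERIV_unique)
    qed
    have g_cont: "continuous_on {0..T} (g q v)" if v: "v \<in> V1" and q: "q \<in> V2" for v q
    proof -
      \<comment> \<open>Constant variations need not vanish at 0, but for them the integrand is
        exactly \<open>g q v\<close>.\<close>
      have "(\<lambda>_. v, \<lambda>_. q) \<in> phase_curves T N1 V1 N2 V2"
        using scaled_vector_curve[OF T V1 N1 v, of "\<lambda>_. 1" "\<lambda>_. 0"]
          scaled_vector_curve[OF T V2 N2 q, of "\<lambda>_. 1" "\<lambda>_. 0"]
        unfolding phase_curves_def by simp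
      from variation(1)[OF this] show ?thesis unfolding g_def .
    qed
    have g_zero: "g q v t = 0" if v: "v \<in> V1" and q: "q \<in> V2" and t: "t \<in> {0<..<T}" for v q t
    proof (rule fundamental_lemma_calculus_of_variations[OF g_cont[OF v q] _ t])
      fix \<eta> \<eta>' :: "real \<Rightarrow> real"
      assume "\<And>t. (\<eta> has_real_derivative \<eta>' t) (at t)" "continuous_on UNIV \<eta>'" "\<eta> 0 = 0" "\<eta> T = 0"
      then show "integral {0..T} (\<lambda>t. \<eta> t * g q v t) = 0"
        using scaled[of \<eta> \<eta>' v q] v q by simp
    qed
    have zero: "0 \<in> V1" "0 \<in> V2" using V1 V2 by (auto intro: subspace_0)
    have "ey t = 0" "ep t = 0" if t: "t \<in> {0<..<T}" for t
    proof -
      \<comment> \<open>Taking \<open>v = 0\<close> isolates \<open>ey\<close>, and below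
        \<open>q = 0\<close> isolates \<open>ep\<close>; density extends each identity to all test
        vectors.\<close>
      have "blinfun_apply q (ey t) = 0" for q :: "'a \<Rightarrow>\<^sub>L real"
        by (rule dense_zero_imp_zero[where V = V2])
          (use g_zero[OF zero(1) _ t] assms(8) in \<open>auto simp: g_def intro: blinfun.bounded_linear_left\<close>)
      then show "ey t = 0" by (rule dual_separates_points)
      have "blinfun_apply (ep t) v = 0" for v
        by (rule dense_zero_imp_zero[where V = V1])
          (use g_zero[OF _ zero(2) t] assms(3) in \<open>auto simp: g_def intro: blinfun.bounded_linear_right\<close>)
      then show "ep t = 0" by (intro blinfun_eqI) simp
    qed
    moreover have "blinfun_apply (\<pi> T - \<pi>1 (\<phi> T)) v = 0" for v
    proof (rule dense_zero_imp_zero[where V = V1])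
      fix v assume v: "v \<in> V1"
      \<comment> \<open>\<open>g_zero\<close> covers interior times; the two endpoints do not affect
        the integral.\<close>
      have "integral {0..T} (\<lambda>t. t * g 0 v t) = integral {0<..<T} (\<lambda>t. t * g 0 v t)"
        by (rule integral_open_interval_real)
      also have "\<dots> = integral {0<..<T} (\<lambda>t. 0)"
        using g_zero[OF v zero(2)] by (intro integral_cong) simp
      \<comment> \<open>With the weight \<open>t\<close> the boundary term at \<open>T\<close>
        survives and carries the factor \<open>T\<close>, which is positive and cancels.\<close>
      finally have "blinfun_apply (\<pi>1 (\<phi> T)) (T *\<^sub>R v) = blinfun_apply (\<pi> T) (T *\<^sub>R v)"
        using scaled[of "\<lambda>t. t" "\<lambda>_. 1" v 0] v zero(2) by simp
      then show "blinfun_apply (\<pi> T - \<pi>1 (\<phi> T)) v = 0"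
        using T by (simp add: blinfun.scaleR_right blinfun.diff_left)
    qed (use assms(3) in \<open>auto intro: blinfun.bounded_linear_right\<close>)
    then have "\<pi> T - \<pi>1 (\<phi> T) = 0" by (intro blinfun_eqI) simp
    ultimately show "(\<forall>t\<in>{0<..<T}. ey t = 0 \<and> ep t = 0) \<and> \<pi> T = \<pi>1 (\<phi> T)" by simp
  next
    assume *: "(\<forall>t\<in>{0<..<T}. ey t = 0 \<and> ep t = 0) \<and> \<pi> T = \<pi>1 (\<phi> T)"
    have "has_action_variation T H \<phi> \<pi> \<delta>\<phi> \<delta>\<pi> (blinfun_apply (\<pi>1 (\<phi> T)) (\<delta>\<phi> T))"
      if "(\<delta>\<phi>, \<delta>\<pi>) \<in> partial_variations T N1 V1 N2 V2" for \<delta>\<phi> \<delta>\<pi>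
    proof -
      have pc: "(\<delta>\<phi>, \<delta>\<pi>) \<in> phase_curves T N1 V1 N2 V2" and d0: "\<delta>\<phi> 0 = 0"
        using that unfolding partial_variations_def by auto
      let ?g = "\<lambda>t. blinfun_apply (\<delta>\<pi> t) (ey t) - blinfun_apply (ep t) (\<delta>\<phi> t)"
      \<comment> \<open>The residuals vanish at interior times, so only the boundary pairing at
        \<open>T\<close> is left in the variation formula.\<close>
      have "integral {0..T} ?g = integral {0<..<T} ?g"
        by (rule integral_open_interval_real)
      also have "\<dots> = integral {0<..<T} (\<lambda>t. 0)"
        using * by (intro integral_cong) simp
      finally show ?thesis using variation(2)[OF pc] d0 * by simp
    qed
    then show "\<forall>(\<delta>\<phi>, \<delta>\<pi>) \<in> partial_variations T N1 V1 N2 V2.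
            has_action_variation T H \<phi> \<pi> \<delta>\<phi> \<delta>\<pi> (blinfun_apply (\<pi>1 (\<phi> T)) (\<delta>\<phi> T))"
      by blast
  qed
  with eqs init show ?thesis by simp
qed

end
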